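(* Let $\alpha>0$ with $n-1\le \alpha <n$ for a positive integer $n$, let $m\ge0$ be an integer and $1< p<\infty$. In order that $u\in I_{a+}^\alpha[W^{m,p}(\Omega)]$, it is necessary and sufficient that $${}_{a}I_{x}^{n-\alpha}u\in W^{m+n,p}(\Omega)$$ and that $${}_{a}D_{x}^{\alpha-k}u(x)\big|_{x=a}=0,\qquad k=1,2,\ldots,n.$$
   Context: $\Omega=[a,b]$ is a closed bounded interval, functions are real-valued and $u\in L_1(\Omega)$, $D=\frac{d}{dx}$. For $\beta>0$ and $v\in L_1(\Omega)$, ${}_{a}I_{x}^{\beta}v(x):=\frac{1}{\Gamma(\beta)}\int_{a}^x(x-s)^{\beta-1}v(s)\,ds$. For $k=1,\ldots,n$, ${}_{a}D_{x}^{\alpha-k}u:=D^{n-k}\,{}_{a}I_{x}^{n-\alpha}u$. $W^{m,p}(\Omega)$ is the classical Sobolev space of functions with weak derivatives up to order $m$ in $L_p(\Omega)$ (so $W^{0,p}(\Omega)=L_p(\Omega)$), and $I_{a+}^\alpha[W^{m,p}(\Omega)]:=\{f:f(x)={}_{a}I_{x}^\alpha \varphi(x),\ \varphi\in W^{m,p}(\Omega),\ x\in\Omega\}$. *)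

theory Defs
  imports "HOL-Analysis.Analysis"
begin

text \<open>
  Elements of the function spaces below are represented by functions on the whole real line of
  which only the values on \<open>[a, b]\<close> matter. Equality of such elements is equality almost
  everywhere, so every notion here is invariant under changes on a null set.
\<close>

definition Lp_on :: "real \<Rightarrow> real set \<Rightarrow> (real \<Rightarrow> real) set" where
  "Lp_on p S = {f. f \<in> borel_measurable (lebesgue_on S) \<and>
                   integrable (lebesgue_on S) (\<lambda>x. \<bar>f x\<bar> powr p)}"

definition test_fun :: "real \<Rightarrow> real \<Rightarrow> (real \<Rightarrow> real) \<Rightarrow> bool" where
  "test_fun a b \<phi> \<longleftrightarrow>
     (\<forall>k x. ((deriv ^^ k) \<phi>) differentiable (at x)) \<and> closure {x. \<phi> x \<noteq> 0} \<subseteq> {a<..<b}"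

definition locally_integrable_on :: "(real \<Rightarrow> real) \<Rightarrow> real set \<Rightarrow> bool" where
  "locally_integrable_on f S \<longleftrightarrow>
     (\<forall>K. compact K \<and> K \<subseteq> S \<longrightarrow> f absolutely_integrable_on K)"

text \<open>\<open>g\<close> is a weak derivative of order \<open>k\<close> of \<open>f\<close> on the open interval \<open>(a, b)\<close>.\<close>

definition has_weak_deriv ::
    "real \<Rightarrow> real \<Rightarrow> nat \<Rightarrow> (real \<Rightarrow> real) \<Rightarrow> (real \<Rightarrow> real) \<Rightarrow> bool" where
  "has_weak_deriv a b k f g \<longleftrightarrow>
     locally_integrable_on f {a<..<b} \<and> locally_integrable_on g {a<..<b} \<and>
     (\<forall>\<phi>. test_fun a b \<phi> \<longrightarrow>
        (LINT x:{a<..<b}|lebesgue. f x * (deriv ^^ k) \<phi> x) =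
        (- 1) ^ k * (LINT x:{a<..<b}|lebesgue. g x * \<phi> x))"

definition sobolev :: "nat \<Rightarrow> real \<Rightarrow> real \<Rightarrow> real \<Rightarrow> (real \<Rightarrow> real) set" where
  "sobolev m p a b =
     {f \<in> Lp_on p {a..b}. \<forall>k\<in>{1..m}. \<exists>g\<in>Lp_on p {a..b}. has_weak_deriv a b k f g}"

text \<open>
  The left-sided Riemann--Liouville integral of order \<open>\<beta> > 0\<close> with base point \<open>a\<close>. For integrable
  \<open>v\<close> the integral exists for almost every \<open>x\<close>; on the exceptional null set the value is a dummy.
\<close>

definition RL_integral :: "real \<Rightarrow> real \<Rightarrow> (real \<Rightarrow> real) \<Rightarrow> real \<Rightarrow> real" where
  "RL_integral a \<beta> v x =
     1 / Gamma \<beta> * (LINT s:{a..x}|lebesgue. (x - s) powr (\<beta> - 1) * v s)"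

definition RL_image ::
    "real \<Rightarrow> real \<Rightarrow> real \<Rightarrow> (real \<Rightarrow> real) set \<Rightarrow> (real \<Rightarrow> real) set" where
  "RL_image a b \<alpha> S =
     {f. \<exists>\<phi>\<in>S. AE x in lebesgue_on {a..b}. f x = RL_integral a \<alpha> \<phi> x}"

text \<open>
  \<open>g\<close> is (a representative of) the Riemann--Liouville derivative of order \<open>\<alpha> - k\<close> of \<open>u\<close>, that is
  \<open>D^(n-k)\<close> applied to the integral of order \<open>n - \<alpha>\<close>. It is meant for \<open>1 \<le> k \<le> n\<close>.
\<close>

definition has_RL_deriv ::
    "real \<Rightarrow> real \<Rightarrow> nat \<Rightarrow> real \<Rightarrow> nat \<Rightarrow> (real \<Rightarrow> real) \<Rightarrow> (real \<Rightarrow> real) \<Rightarrow> bool" where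
  "has_RL_deriv a b n \<alpha> k u g \<longleftrightarrow>
     has_weak_deriv a b (n - k) (RL_integral a (real n - \<alpha>) u) g"

text \<open>
  The value at \<open>a\<close> of an element given only up to a null set is that of its continuous
  representative on \<open>[a, b]\<close>, which is unique if it exists. The raw value
  \<open>RL_integral a \<beta> u a\<close> could not serve here: being an integral over \<open>{a..a}\<close>, it is always \<open>0\<close>.
\<close>

definition has_left_value :: "real \<Rightarrow> real \<Rightarrow> (real \<Rightarrow> real) \<Rightarrow> real \<Rightarrow> bool" where
  "has_left_value a b f c \<longleftrightarrow>
     (\<exists>h. continuous_on {a..b} h \<and> (AE x in lebesgue_on {a..b}. f x = h x) \<and> h a = c)"

end

theory Submission
  imports Defs
begin

text \<open>
  Put \<open>\<beta> = n - \<alpha>\<close>, which is positive, and write \<open>J\<close> for the operator \<open>primitive a\<close>, which takes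
  \<open>v\<close> to its integral from \<open>a\<close> to \<open>x\<close>. Everything rests on the semigroup law of fractional
  integration, which gives \<open>I\<^sup>\<beta> (I\<^sup>\<alpha> \<phi>) = I\<^sup>n \<phi> = J\<^sup>n \<phi>\<close> almost everywhere
  (\<open>RL_integral_semigroup\<close>, \<open>RL_integral_nat\<close>). It comes from Fubini's theorem, because convolving
  two of the kernels \<open>t\<^sup>\<beta>\<^sup>-\<^sup>1 / \<Gamma>(\<beta>)\<close> is Euler's Beta integral.

  If \<open>u = I\<^sup>\<alpha> \<phi>\<close> with \<open>\<phi>\<close> in the Sobolev space of order \<open>m\<close>, then \<open>w = I\<^sup>\<beta> u\<close> is \<open>J\<^sup>n \<phi>\<close>. Its weak
  derivatives of orders \<open>j < n\<close> are the functions \<open>J\<^sup>n\<^sup>-\<^sup>j \<phi>\<close>, which are continuous and vanish at \<open>a\<close>;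
  the one of order \<open>n\<close> is \<open>\<phi>\<close>, and beyond that they are the weak derivatives of \<open>\<phi>\<close>
  (\<open>has_weak_deriv_primitive_funpow\<close>, \<open>has_weak_deriv_trans\<close>).

  Conversely let \<open>\<phi>\<close> be the weak derivative of order \<open>n\<close> of \<open>w\<close>. It lies in the Sobolev space of order
  \<open>m\<close> (\<open>has_weak_deriv_cancel\<close>). A weakly differentiable function with a continuous representative
  that vanishes at \<open>a\<close> is \<open>J\<close> of its weak derivative
  (\<open>continuous_representative_eq_primitive\<close>), so the conditions at \<open>a\<close> allow to integrate \<open>n\<close> times
  and to find \<open>w = J\<^sup>n \<phi>\<close> (\<open>left_values_zero_imp_eq_primitive_funpow\<close>). Hence
  \<open>I\<^sup>\<beta> u = I\<^sup>\<beta> (I\<^sup>\<alpha> \<phi>)\<close>, and \<open>u = I\<^sup>\<alpha> \<phi>\<close> because \<open>I\<^sup>\<beta>\<close> is injective on integrable functions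
  (\<open>RL_integral_inject\<close>).

  That weak derivatives and constants of integration are unique reduces to the fundamental lemma of
  the calculus of variations and to the lemma of du Bois-Reymond. These need enough test functions,
  which are built from
  \<open>exp (- 1 / x)\<close>.
\<close>

section \<open>The kernel of fractional integration\<close>

definition rl_kernel :: "real \<Rightarrow> real \<Rightarrow> real" where
  "rl_kernel \<beta> t = (if 0 < t then t powr (\<beta> - 1) / Gamma \<beta> else 0)"

lemma rl_kernel_measurable [measurable]: "rl_kernel \<beta> \<in> borel_measurable borel"
  unfolding rl_kernel_def by measurable

lemma rl_kernel_nonneg: "0 < \<beta> \<Longrightarrow> 0 \<le> rl_kernel \<beta> t"
  by (simp add: rl_kernel_def Gamma_real_pos less_imp_le)

lemma rl_kernel_nonpos_arg [simp]: "t \<le> 0 \<Longrightarrow> rl_kernel \<beta> t = 0"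
  by (simp add: rl_kernel_def)

lemma rl_kernel_1: "0 < t \<Longrightarrow> rl_kernel 1 t = 1"
  by (simp add: rl_kernel_def)

lemma nn_integral_Beta_real:
  assumes "0 < \<alpha>" "0 < \<beta>"
  shows "(\<integral>\<^sup>+ y. ennreal (indicator {0..1} y * (y powr (\<beta> - 1) * (1 - y) powr (\<alpha> - 1))) \<partial>lborel)
    = ennreal (Beta \<beta> \<alpha>)"
proof (rule nn_integral_has_integral_lborel)
  show "((\<lambda>y. indicator {0..1} y * (y powr (\<beta> - 1) * (1 - y) powr (\<alpha> - 1)))
      has_integral Beta \<beta> \<alpha>) UNIV"
    using has_integral_Beta_real[OF assms(2,1)]
    by (subst (asm) has_integral_restrict_UNIV[symmetric])
       (simp add: indicator_def of_bool_def if_distrib[of "\<lambda>x. x * _"] cong: if_cong)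
qed (auto simp: indicator_def)

text \<open>
  The substitution \<open>s = t + (x - t) y\<close> turns this into the Beta integral
  \<open>B(\<beta>, \<alpha>) = \<Gamma>(\<alpha>) \<Gamma>(\<beta>) / \<Gamma>(\<alpha> + \<beta>)\<close>; the Gamma factors of the kernels are chosen for that.
\<close>
lemma rl_kernel_convolution:
  assumes "0 < \<alpha>" "0 < \<beta>"
  shows "(\<integral>\<^sup>+ s. ennreal (rl_kernel \<alpha> (x - s) * rl_kernel \<beta> (s - t)) \<partial>lborel)
    = ennreal (rl_kernel (\<alpha> + \<beta>) (x - t))"
proof (cases "t < x")
  case False
  then have "(\<lambda>s. ennreal (rl_kernel \<alpha> (x - s) * rl_kernel \<beta> (s - t))) = (\<lambda>s. 0)"
    by (auto simp: rl_kernel_def)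
  then show ?thesis using False by simp
next
  case True
  define c where "c = x - t"
  have c: "c > 0" using True by (simp add: c_def)
  have eq: "c * (rl_kernel \<alpha> (x - (t + c * y)) * rl_kernel \<beta> ((t + c * y) - t))
      = (c powr (\<alpha> + \<beta> - 1) / (Gamma \<alpha> * Gamma \<beta>)) *
        (indicator {0..1} y * (y powr (\<beta> - 1) * (1 - y) powr (\<alpha> - 1)))" for y
  proof (cases "0 < y \<and> y < 1")
    case True
    have "x - (t + c * y) = c * (1 - y)" by (simp add: c_def algebra_simps)
    then have "rl_kernel \<alpha> (x - (t + c * y)) = c powr (\<alpha> - 1) * (1 - y) powr (\<alpha> - 1) / Gamma \<alpha>"
      using c True by (simp only: rl_kernel_def) (simp add: powr_mult)
    moreover have "rl_kernel \<beta> ((t + c * y) - t) = c powr (\<beta> - 1) * y powr (\<beta> - 1) / Gamma \<beta>"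
      using c True by (simp add: rl_kernel_def powr_mult)
    moreover have "c powr (\<alpha> + \<beta> - 1) = c * (c powr (\<alpha> - 1) * c powr (\<beta> - 1))"
      using c by (simp add: powr_add[symmetric] powr_mult_base algebra_simps)
    ultimately show ?thesis using True by simp
  next
    case False
    then have "y \<le> 0 \<or> 1 \<le> y" by auto
    then show ?thesis
    proof
      assume "y \<le> 0"
      then show ?thesis using c
        by (cases "y = 0") (auto simp: indicator_def mult_le_0_iff)
    next
      assume y: "1 \<le> y"
      then have "c \<le> c * y" using c mult_left_mono[of 1 y c] by simp
      then have "x - (t + c * y) \<le> 0" using c_def by linarith
      then show ?thesis using c y by (cases "y = 1") (auto simp: indicator_def)
    qed
  qed
  have "(\<integral>\<^sup>+ s. ennreal (rl_kernel \<alpha> (x - s) * rl_kernel \<beta> (s - t)) \<partial>lborel)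
    = \<bar>c\<bar> * (\<integral>\<^sup>+ y. ennreal (rl_kernel \<alpha> (x - (t + c * y)) * rl_kernel \<beta> ((t + c * y) - t)) \<partial>lborel)"
    using c by (intro nn_integral_real_affine) auto
  also have "\<dots> = (\<integral>\<^sup>+ y. ennreal (c * (rl_kernel \<alpha> (x - (t + c * y)) * rl_kernel \<beta> ((t + c * y) - t))) \<partial>lborel)"
    using c assms by (subst nn_integral_cmult[symmetric]) (auto simp: ennreal_mult rl_kernel_nonneg)
  also have "\<dots> = ennreal (c powr (\<alpha> + \<beta> - 1) / (Gamma \<alpha> * Gamma \<beta>)) * ennreal (Beta \<beta> \<alpha>)"
    unfolding eq using assms
    by (subst ennreal_mult) (auto simp: Gamma_real_pos less_imp_le nn_integral_cmult nn_integral_Beta_real)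
  also have "\<dots> = ennreal (rl_kernel (\<alpha> + \<beta>) (x - t))"
  proof -
    have "Gamma \<alpha> > 0" "Gamma \<beta> > 0" "Gamma (\<alpha> + \<beta>) > 0"
      using assms by (auto intro: Gamma_real_pos)
    then have "c powr (\<alpha> + \<beta> - 1) / (Gamma \<alpha> * Gamma \<beta>) * Beta \<beta> \<alpha> = rl_kernel (\<alpha> + \<beta>) c"
      using c by (simp add: Beta_def rl_kernel_def field_simps add.commute)
    then show ?thesis using \<open>Gamma \<alpha> > 0\<close> \<open>Gamma \<beta> > 0\<close>
      by (subst ennreal_mult'[symmetric]) (auto simp: c_def)
  qed
  finally show ?thesis .
qed

text \<open>
  The kernels are nonnegative, so integrating the modulus over \<open>s\<close> first gives exactly
  \<open>rl_kernel (\<alpha> + \<beta>) (x - t) * \<bar>v t\<bar>\<close>. Thus one integrability condition at \<open>x\<close> is all that Fubini's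
  theorem asks for.
\<close>
lemma rl_kernel_pair_integrable:
  assumes "0 < \<alpha>" "0 < \<beta>" and [measurable]: "v \<in> borel_measurable borel"
    and int: "integrable lborel (\<lambda>t. rl_kernel (\<alpha> + \<beta>) (x - t) * v t)"
  shows "integrable (lborel \<Otimes>\<^sub>M lborel) (\<lambda>(s, t). rl_kernel \<alpha> (x - s) * (rl_kernel \<beta> (s - t) * v t))"
proof (rule integrableI_bounded)
  have "(\<integral>\<^sup>+ z. norm (case z of (s, t) \<Rightarrow> rl_kernel \<alpha> (x - s) * (rl_kernel \<beta> (s - t) * v t))
          \<partial>(lborel \<Otimes>\<^sub>M lborel))
      = (\<integral>\<^sup>+ t. (\<integral>\<^sup>+ s. norm (rl_kernel \<alpha> (x - s) * (rl_kernel \<beta> (s - t) * v t)) \<partial>lborel) \<partial>lborel)"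
    by (subst lborel_pair.nn_integral_snd[symmetric]) auto
  also have "\<dots> = (\<integral>\<^sup>+ t. ennreal (rl_kernel (\<alpha> + \<beta>) (x - t)) * ennreal \<bar>v t\<bar> \<partial>lborel)"
  proof (rule nn_integral_cong)
    fix t
    have "(\<integral>\<^sup>+ s. norm (rl_kernel \<alpha> (x - s) * (rl_kernel \<beta> (s - t) * v t)) \<partial>lborel)
      = (\<integral>\<^sup>+ s. ennreal (rl_kernel \<alpha> (x - s) * rl_kernel \<beta> (s - t)) * ennreal \<bar>v t\<bar> \<partial>lborel)"
      using assms(1,2)
      by (intro nn_integral_cong)
         (auto simp: abs_mult rl_kernel_nonneg ennreal_mult[symmetric] mult.assoc)
    also have "\<dots> = ennreal (rl_kernel (\<alpha> + \<beta>) (x - t)) * ennreal \<bar>v t\<bar>"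
      using assms(1,2) by (subst nn_integral_multc) (auto simp: rl_kernel_convolution)
    finally show "(\<integral>\<^sup>+ s. norm (rl_kernel \<alpha> (x - s) * (rl_kernel \<beta> (s - t) * v t)) \<partial>lborel)
      = ennreal (rl_kernel (\<alpha> + \<beta>) (x - t)) * ennreal \<bar>v t\<bar>" .
  qed
  also have "\<dots> = (\<integral>\<^sup>+ t. norm (rl_kernel (\<alpha> + \<beta>) (x - t) * v t) \<partial>lborel)"
    using assms(1,2)
    by (intro nn_integral_cong) (auto simp: abs_mult rl_kernel_nonneg ennreal_mult)
  also have "\<dots> < \<infinity>"
    using int by (simp add: integrable_iff_bounded)
  finally show "(\<integral>\<^sup>+ z. norm (case z of (s, t) \<Rightarrow> rl_kernel \<alpha> (x - s) * (rl_kernel \<beta> (s - t) * v t))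
          \<partial>(lborel \<Otimes>\<^sub>M lborel)) < \<infinity>" .
qed measurable

lemma rl_kernel_convolution_integral:
  assumes "0 < \<alpha>" "0 < \<beta>"
  shows "(\<integral> s. rl_kernel \<alpha> (x - s) * rl_kernel \<beta> (s - t) \<partial>lborel) = rl_kernel (\<alpha> + \<beta>) (x - t)"
  using assms rl_kernel_convolution[OF assms, of x t]
  by (subst integral_eq_nn_integral) (auto simp: rl_kernel_nonneg)

lemma rl_kernel_convolution_assoc:
  assumes "0 < \<alpha>" "0 < \<beta>" and [measurable]: "v \<in> borel_measurable borel"
    and int: "integrable lborel (\<lambda>t. rl_kernel (\<alpha> + \<beta>) (x - t) * v t)"
  shows "(\<integral> s. rl_kernel \<alpha> (x - s) * (\<integral> t. rl_kernel \<beta> (s - t) * v t \<partial>lborel) \<partial>lborel)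
       = (\<integral> t. rl_kernel (\<alpha> + \<beta>) (x - t) * v t \<partial>lborel)"
proof -
  have "(\<integral> s. rl_kernel \<alpha> (x - s) * (\<integral> t. rl_kernel \<beta> (s - t) * v t \<partial>lborel) \<partial>lborel)
      = (\<integral> s. (\<integral> t. rl_kernel \<alpha> (x - s) * (rl_kernel \<beta> (s - t) * v t) \<partial>lborel) \<partial>lborel)"
    by simp
  also have "\<dots> = (\<integral> t. (\<integral> s. rl_kernel \<alpha> (x - s) * (rl_kernel \<beta> (s - t) * v t) \<partial>lborel) \<partial>lborel)"
    by (rule lborel_pair.Fubini_integral[symmetric])
       (use rl_kernel_pair_integrable[OF assms] in simp)
  also have "\<dots> = (\<integral> t. (\<integral> s. rl_kernel \<alpha> (x - s) * rl_kernel \<beta> (s - t) \<partial>lborel) * v t \<partial>lborel)"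
    by (simp add: mult.assoc[symmetric])
  finally show ?thesis using assms by (simp add: rl_kernel_convolution_integral)
qed

text \<open>
  For \<open>\<gamma> \<ge> 1\<close> the kernel has no singularity, hence the condition of \<open>rl_kernel_pair_integrable\<close> holds
  at every \<open>x\<close>. With \<open>\<gamma> = 1 + \<beta>\<close> and \<open>x = b\<close> this yields integrability of the fractional integral of
  order \<open>\<beta>\<close> for all \<open>\<beta> > 0\<close>.
\<close>
lemma integrable_rl_kernel_bounded:
  assumes "1 \<le> \<gamma>" and v: "integrable lborel v" and supp: "\<And>t. t < a \<Longrightarrow> v t = 0"
  shows "integrable lborel (\<lambda>t. rl_kernel \<gamma> (x - t) * v t)"
proof (rule Bochner_Integration.integrable_bound)
  show "integrable lborel (\<lambda>t. ((x - a) powr (\<gamma> - 1) / Gamma \<gamma>) * v t)"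
    using v by simp
  have "\<bar>rl_kernel \<gamma> (x - t) * v t\<bar> \<le> \<bar>((x - a) powr (\<gamma> - 1) / Gamma \<gamma>) * v t\<bar>" for t
  proof (cases "a \<le> t \<and> t < x")
    case True
    then have "(x - t) powr (\<gamma> - 1) \<le> (x - a) powr (\<gamma> - 1)"
      using assms by (intro powr_mono2) auto
    then show ?thesis using True assms Gamma_real_pos[of \<gamma>]
      by (simp add: rl_kernel_def abs_mult divide_right_mono mult_right_mono)
  next
    case False
    then show ?thesis using supp[of t] by (cases "t < a") auto
  qed
  then show "AE t in lborel. norm (rl_kernel \<gamma> (x - t) * v t) \<le> norm (((x - a) powr (\<gamma> - 1) / Gamma \<gamma>) * v t)"
    by simp
qed (use v in measurable)

section \<open>Fractional integrals of integrable functions\<close>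
lemma AE_lebesgue_on_imp_negligible:
  fixes S :: "real set"
  assumes "S \<in> sets lebesgue" "AE x in lebesgue_on S. P x"
  obtains N where "negligible N" "\<And>x. x \<in> S - N \<Longrightarrow> P x"
proof -
  have "AE x in lebesgue. x \<in> S \<longrightarrow> P x"
    using assms by (simp add: AE_restrict_space_iff)
  then have "{x. \<not> (x \<in> S \<longrightarrow> P x)} \<in> null_sets lebesgue"
    by (simp add: completion.AE_iff_null_sets)
  then show ?thesis
    by (intro that[of "{x. \<not> (x \<in> S \<longrightarrow> P x)}"]) (auto simp: negligible_iff_null_sets)
qed

lemma absolutely_integrable_cong_AE:
  fixes f g :: "real \<Rightarrow> real"
  assumes "f absolutely_integrable_on {a..b}" "AE x in lebesgue_on {a..b}. f x = g x"
  shows "g absolutely_integrable_on {a..b}"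
proof -
  obtain N where "negligible N" "\<And>x. x \<in> {a..b} - N \<Longrightarrow> f x = g x"
    using AE_lebesgue_on_imp_negligible[OF _ assms(2)] by auto
  then show ?thesis
    by (intro absolutely_integrable_spike[OF assms(1), where S = N]) auto
qed

lemma integral_cong_AE_lebesgue_on:
  fixes f g :: "real \<Rightarrow> real"
  assumes "AE x in lebesgue_on {a..b}. f x = g x" "S \<subseteq> {a..b}"
  shows "integral S f = integral S g"
proof -
  obtain N where "negligible N" "\<And>x. x \<in> {a..b} - N \<Longrightarrow> f x = g x"
    using AE_lebesgue_on_imp_negligible[OF _ assms(1)] by auto
  then show ?thesis
    using assms(2) by (intro integral_spike[of N]) auto
qed

text \<open>
  Fubini's theorem on \<open>lborel \<Otimes>\<^sub>M lborel\<close> needs Borel measurable integrands, whereas the functions of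
  interest are only Lebesgue measurable and only determined on \<open>{a..b}\<close>. Extending a Borel
  representative by zero also makes the fractional integral a convolution over the whole line.
\<close>
lemma obtain_borel_representative:
  fixes v :: "real \<Rightarrow> real"
  assumes "v absolutely_integrable_on {a..b}"
  obtains v0 where "v0 \<in> borel_measurable borel" "integrable lborel v0"
    "\<And>t. t \<notin> {a..b} \<Longrightarrow> v0 t = 0" "AE t in lebesgue_on {a..b}. v t = v0 t"
proof -
  let ?v = "\<lambda>t. indicator {a..b} t * v t"
  have int: "integrable lebesgue ?v"
    using assms by (simp add: set_integrable_def)
  then obtain w where [measurable]: "w \<in> borel_measurable lborel" and w: "AE t in lborel. ?v t = w t"
    using completion_ex_borel_measurable_real[of ?v lborel] by auto
  define v0 where "v0 t = indicator {a..b} t * w t" for t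
  have [measurable]: "v0 \<in> borel_measurable borel"
    unfolding v0_def by measurable
  have eq: "AE t in lebesgue. ?v t = v0 t"
    using AE_completion[OF w] by eventually_elim (simp add: v0_def split: split_indicator split_indicator_asm)
  have "integrable lebesgue v0"
    by (rule integrable_cong_AE_imp[OF int]) (use eq in \<open>auto intro: measurable_completion\<close>)
  then have "integrable lborel v0"
    by (simp add: integrable_completion)
  moreover have "AE t in lebesgue_on {a..b}. v t = v0 t"
    using eq by (subst AE_restrict_space_iff) auto
  ultimately show ?thesis
    by (intro that[of v0]) (auto simp: v0_def)
qed

lemma RL_integral_eq_convolution:
  assumes v: "v absolutely_integrable_on {a..b}" and [measurable]: "v0 \<in> borel_measurable borel"
    and supp: "\<And>t. t \<notin> {a..b} \<Longrightarrow> v0 t = 0" and eq: "AE t in lebesgue_on {a..b}. v t = v0 t"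
    and "x \<le> b"
  shows "RL_integral a \<beta> v x = (\<integral> t. rl_kernel \<beta> (x - t) * v0 t \<partial>lborel)"
proof -
  have "(\<lambda>t. indicator {a..b} t * v t) \<in> borel_measurable lebesgue"
    using borel_measurable_integrable v by (auto simp: set_integrable_def)
  moreover have "(\<lambda>t. indicator {a..x} t * (x - t) powr (\<beta> - 1)) \<in> borel_measurable lebesgue"
    by (rule measurable_completion) auto
  ultimately have "(\<lambda>t. (indicator {a..x} t * (x - t) powr (\<beta> - 1)) * (indicator {a..b} t * v t))
      \<in> borel_measurable lebesgue"
    by (rule borel_measurable_times[rotated])
  also have "(\<lambda>t. (indicator {a..x} t * (x - t) powr (\<beta> - 1)) * (indicator {a..b} t * v t))
    = (\<lambda>t. indicator {a..x} t *\<^sub>R ((x - t) powr (\<beta> - 1) * v t))"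
    using \<open>x \<le> b\<close> by (auto simp: indicator_def)
  finally have m: "(\<lambda>t. indicator {a..x} t *\<^sub>R ((x - t) powr (\<beta> - 1) * v t)) \<in> borel_measurable lebesgue" .
  have "AE t in lebesgue. t \<in> {a..b} \<longrightarrow> v t = v0 t"
    using eq by (simp add: AE_restrict_space_iff)
  then have ae: "AE t in lebesgue. indicator {a..x} t *\<^sub>R ((x - t) powr (\<beta> - 1) * v t)
      = Gamma \<beta> * (rl_kernel \<beta> (x - t) * v0 t)" if "Gamma \<beta> \<noteq> 0"
  proof eventually_elim
    case (elim t)
    then show ?case
      using \<open>x \<le> b\<close> supp[of t] that by (auto simp: indicator_def rl_kernel_def)
  qed
  show ?thesis
  proof (cases "Gamma \<beta> = 0")
    case True
    then show ?thesis by (simp add: RL_integral_def rl_kernel_def cong: if_cong)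
  next
    case False
    have "RL_integral a \<beta> v x = 1 / Gamma \<beta> * (\<integral> t. Gamma \<beta> * (rl_kernel \<beta> (x - t) * v0 t) \<partial>lebesgue)"
      unfolding RL_integral_def set_lebesgue_integral_def
      by (subst integral_cong_AE[OF m _ ae[OF False]]) (auto intro!: measurable_completion)
    also have "\<dots> = (\<integral> t. rl_kernel \<beta> (x - t) * v0 t \<partial>lborel)"
      using False by (subst integral_completion) auto
    finally show ?thesis .
  qed
qed

lemma RL_integral_cong_AE:
  assumes "f absolutely_integrable_on {a..b}" "AE x in lebesgue_on {a..b}. f x = g x" "x \<le> b"
  shows "RL_integral a \<beta> f x = RL_integral a \<beta> g x"
proof -
  have g: "g absolutely_integrable_on {a..b}"
    using assms absolutely_integrable_cong_AE by blast
  obtain v0 where v0: "v0 \<in> borel_measurable borel" "integrable lborel v0"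
    "\<And>t. t \<notin> {a..b} \<Longrightarrow> v0 t = 0" "AE t in lebesgue_on {a..b}. f t = v0 t"
    using obtain_borel_representative[OF assms(1)] by blast
  have "AE t in lebesgue_on {a..b}. g t = v0 t"
    using v0(4) assms(2) by eventually_elim simp
  then show ?thesis
    using RL_integral_eq_convolution[OF assms(1) v0(1,3,4) assms(3)]
      RL_integral_eq_convolution[OF g v0(1,3) _ assms(3)] by simp
qed

text \<open>
  The factor \<open>rl_kernel 1 (b - s)\<close>, which is the indicator of \<open>s < b\<close>, makes integrability of the
  fractional integral over \<open>{a..b}\<close> an instance of Fubini's theorem for the kernels of order \<open>1\<close> and
  \<open>\<beta>\<close>. Applied with \<open>\<alpha> + \<beta>\<close> in place of \<open>\<beta>\<close>, the same instance shows that for almost every \<open>x\<close> the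
  integral of order \<open>\<alpha> + \<beta>\<close> converges absolutely; at such \<open>x\<close> the order of integration may be
  exchanged.
\<close>
lemma
  assumes \<beta>: "0 < \<beta>" and v: "v absolutely_integrable_on {a..b}"
  shows RL_integral_absolutely_integrable: "RL_integral a \<beta> v absolutely_integrable_on {a..b}"
    and RL_integral_semigroup: "0 < \<alpha> \<Longrightarrow> AE x in lebesgue_on {a..b}.
      RL_integral a \<alpha> (RL_integral a \<beta> v) x = RL_integral a (\<alpha> + \<beta>) v x"
proof -
  obtain v0 where v0 [measurable]: "v0 \<in> borel_measurable borel" and int: "integrable lborel v0"
    and supp: "\<And>t. t \<notin> {a..b} \<Longrightarrow> v0 t = 0" and eq: "AE t in lebesgue_on {a..b}. v t = v0 t"
    using obtain_borel_representative[OF v] by blast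
  note RL = RL_integral_eq_convolution[OF v v0 supp eq]
  have pair: "integrable (lborel \<Otimes>\<^sub>M lborel) (\<lambda>(s, t). rl_kernel 1 (b - s) * (rl_kernel \<gamma> (s - t) * v0 t))"
    if "0 < \<gamma>" for \<gamma>
    using that supp by (intro rl_kernel_pair_integrable integrable_rl_kernel_bounded[of _ _ a] int) auto
  define C where "C s = (\<integral> t. rl_kernel \<beta> (s - t) * v0 t \<partial>lborel)" for s
  have [measurable]: "C \<in> borel_measurable borel"
    unfolding C_def by measurable
  define w where "w s = rl_kernel 1 (b - s) * C s" for s
  have [measurable]: "w \<in> borel_measurable borel"
    unfolding w_def by measurable
  have w_int: "integrable lborel w"
    using lborel_pair.integrable_fst[OF pair[OF \<beta>]] by (simp add: w_def[abs_def] C_def)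
  have w_supp: "w s = 0" if "s \<notin> {a..b}" for s
  proof (cases "b \<le> s")
    case True
    then show ?thesis by (simp add: w_def)
  next
    case False
    with that have "rl_kernel \<beta> (s - t) * v0 t = 0" for t
      using supp[of t] by (cases "t < a") auto
    then have "C s = 0" unfolding C_def by (simp only: integral_zero)
    then show ?thesis by (simp add: w_def)
  qed
  have RL_w: "RL_integral a \<beta> v s = w s" if "s \<in> {a..b} - {b}" for s
    using that RL[of s \<beta>] by (simp add: w_def C_def rl_kernel_1)
  have "integrable lebesgue w"
    using w_int by (simp add: integrable_completion)
  then have "w absolutely_integrable_on {a..b}"
    unfolding set_integrable_def by (intro integrable_mult_indicator) auto
  then show int': "RL_integral a \<beta> v absolutely_integrable_on {a..b}"
    by (rule absolutely_integrable_spike[where S = "{b}"]) (use RL_w in auto)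
  have eq': "AE t in lebesgue_on {a..b}. RL_integral a \<beta> v t = w t"
  proof (subst AE_restrict_space_iff)
    have "AE t in lebesgue. t \<noteq> b"
      by (intro AE_completion AE_lborel_singleton)
    then show "AE t in lebesgue. t \<in> {a..b} \<longrightarrow> RL_integral a \<beta> v t = w t"
      by eventually_elim (use RL_w in auto)
  qed auto
  show "AE x in lebesgue_on {a..b}. RL_integral a \<alpha> (RL_integral a \<beta> v) x = RL_integral a (\<alpha> + \<beta>) v x"
    if \<alpha>: "0 < \<alpha>"
  proof (subst AE_restrict_space_iff)
    have "AE x in lborel. integrable lborel (\<lambda>t. rl_kernel 1 (b - x) * (rl_kernel (\<alpha> + \<beta>) (x - t) * v0 t))"
      using lborel_pair.AE_integrable_fst[OF pair[of "\<alpha> + \<beta>"]] \<alpha> \<beta> by simp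
    moreover have "AE x in lborel. x \<noteq> b" by (rule AE_lborel_singleton)
    ultimately have "AE x in lborel. x \<in> {a..b} \<longrightarrow>
        RL_integral a \<alpha> (RL_integral a \<beta> v) x = RL_integral a (\<alpha> + \<beta>) v x"
    proof eventually_elim
      case (elim x)
      show ?case
      proof
        assume x: "x \<in> {a..b}"
        have "rl_kernel 1 (b - x) = 1"
          using x elim(2) by (simp add: rl_kernel_1)
        then have I: "integrable lborel (\<lambda>t. rl_kernel (\<alpha> + \<beta>) (x - t) * v0 t)"
          using elim(1) by simp
        have "RL_integral a \<alpha> (RL_integral a \<beta> v) x = (\<integral> s. rl_kernel \<alpha> (x - s) * w s \<partial>lborel)"
          using x by (intro RL_integral_eq_convolution[OF int' _ w_supp eq']) auto
        also have "\<dots> = (\<integral> s. rl_kernel \<alpha> (x - s) * C s \<partial>lborel)"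
        proof (rule Bochner_Integration.integral_cong)
          fix s
          show "rl_kernel \<alpha> (x - s) * w s = rl_kernel \<alpha> (x - s) * C s"
            using x by (cases "s < x") (auto simp: w_def rl_kernel_1)
        qed simp
        also have "\<dots> = (\<integral> t. rl_kernel (\<alpha> + \<beta>) (x - t) * v0 t \<partial>lborel)"
          unfolding C_def using \<alpha> \<beta> I by (intro rl_kernel_convolution_assoc) auto
        also have "\<dots> = RL_integral a (\<alpha> + \<beta>) v x"
          using x by (intro RL[symmetric]) auto
        finally show "RL_integral a \<alpha> (RL_integral a \<beta> v) x = RL_integral a (\<alpha> + \<beta>) v x" .
      qed
    qed
    then show "AE x in lebesgue. x \<in> {a..b} \<longrightarrow>
        RL_integral a \<alpha> (RL_integral a \<beta> v) x = RL_integral a (\<alpha> + \<beta>) v x"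
      by (rule AE_completion)
  qed auto
qed

definition primitive :: "real \<Rightarrow> (real \<Rightarrow> real) \<Rightarrow> real \<Rightarrow> real" where
  "primitive a v x = integral {a..x} v"

lemma primitive_at_base [simp]: "primitive a v a = 0"
  by (simp add: primitive_def)

lemma continuous_on_primitive:
  "v absolutely_integrable_on {a..b} \<Longrightarrow> continuous_on {a..b} (primitive a v)"
  unfolding primitive_def[abs_def]
  by (rule indefinite_integral_continuous_1[OF set_lebesgue_integral_eq_integral(1)])

lemma primitive_absolutely_integrable:
  "v absolutely_integrable_on {a..b} \<Longrightarrow> primitive a v absolutely_integrable_on {a..b}"
  by (rule absolutely_integrable_continuous_real[OF continuous_on_primitive])

lemma primitive_cong_AE:
  assumes "AE x in lebesgue_on {a..b}. f x = g x" "x \<in> {a..b}"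
  shows "primitive a f x = primitive a g x"
  unfolding primitive_def
  by (rule integral_cong_AE_lebesgue_on[OF assms(1)]) (use assms(2) in auto)

lemma primitive_funpow_absolutely_integrable:
  "v absolutely_integrable_on {a..b} \<Longrightarrow> (primitive a ^^ n) v absolutely_integrable_on {a..b}"
  by (induction n) (auto intro: primitive_absolutely_integrable)

lemma RL_integral_1:
  assumes "v absolutely_integrable_on {a..b}" "x \<in> {a..b}"
  shows "RL_integral a 1 v x = primitive a v x"
proof -
  have v: "v absolutely_integrable_on {a..x}"
    using assms by (intro set_integrable_subset[OF assms(1)]) auto
  have "(\<lambda>s. (x - s) powr 0 * v s) absolutely_integrable_on {a..x}"
    by (rule absolutely_integrable_spike[OF v, where S = "{x}"]) auto
  then have "RL_integral a 1 v x = integral {a..x} (\<lambda>s. (x - s) powr 0 * v s)"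
    by (simp add: RL_integral_def set_lebesgue_integral_eq_integral(2))
  also have "\<dots> = integral {a..x} v"
    by (rule integral_spike[where S = "{x}"]) auto
  finally show ?thesis by (simp add: primitive_def)
qed

lemma RL_integral_nat:
  assumes v: "v absolutely_integrable_on {a..b}"
  shows "AE x in lebesgue_on {a..b}. RL_integral a (real (Suc n)) v x = (primitive a ^^ Suc n) v x"
proof (induction n)
  case 0
  then show ?case using assms by (auto intro!: AE_I2 simp: RL_integral_1 space_restrict_space)
next
  case (Suc n)
  have "AE x in lebesgue_on {a..b}. RL_integral a 1 (RL_integral a (real (Suc n)) v) x
      = RL_integral a (1 + real (Suc n)) v x"
    using v by (intro RL_integral_semigroup) auto
  moreover have "AE x in lebesgue_on {a..b}. RL_integral a 1 (RL_integral a (real (Suc n)) v) x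
      = primitive a ((primitive a ^^ Suc n) v) x"
  proof (rule AE_I2)
    fix x assume "x \<in> space (lebesgue_on {a..b})"
    then have x: "x \<in> {a..b}" by (simp add: space_restrict_space)
    have "RL_integral a 1 (RL_integral a (real (Suc n)) v) x = primitive a (RL_integral a (real (Suc n)) v) x"
      using v x by (intro RL_integral_1 RL_integral_absolutely_integrable) auto
    also have "\<dots> = primitive a ((primitive a ^^ Suc n) v) x"
      by (rule primitive_cong_AE[OF Suc x])
    finally show "RL_integral a 1 (RL_integral a (real (Suc n)) v) x
      = primitive a ((primitive a ^^ Suc n) v) x" .
  qed
  ultimately show ?case
    by eventually_elim (simp add: add.commute)
qed

section \<open>An integrable function is determined by its primitive\<close>

text \<open>
  The hypothesis says that the finite measures with densities the positive and the negative part of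
  \<open>f\<close> agree on all half-lines. They are therefore equal, and so are their densities.
\<close>
lemma AE_zero_of_half_line_integrals:
  fixes f :: "real \<Rightarrow> real"
  assumes int: "integrable lborel f" and zero: "\<And>x. (LINT t:{x<..}|lborel. f t) = 0"
  shows "AE t in lborel. f t = 0"
proof -
  have [measurable]: "f \<in> borel_measurable borel"
    using borel_measurable_integrable[OF int] by simp
  let ?P = "density lborel (\<lambda>t. ennreal (max 0 (f t)))"
  let ?N = "density lborel (\<lambda>t. ennreal (max 0 (- f t)))"
  have part: "emeasure (density lborel (\<lambda>t. ennreal (max 0 (g t)))) {x<..}
      = ennreal (LINT t:{x<..}|lborel. max 0 (g t))" if g: "integrable lborel g" for g :: "real \<Rightarrow> real" and x
  proof -
    have [measurable]: "g \<in> borel_measurable borel"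
      using borel_measurable_integrable[OF g] by simp
    have "integrable lborel (\<lambda>t. max 0 (g t))"
      using g by (intro integrable_max) auto
    then have i: "integrable lborel (\<lambda>t. indicator {x<..} t * max 0 (g t))"
      using integrable_mult_indicator[of "{x<..}" lborel "\<lambda>t. max 0 (g t)"] by simp
    have "emeasure (density lborel (\<lambda>t. ennreal (max 0 (g t)))) {x<..}
      = (\<integral>\<^sup>+ t. ennreal (indicator {x<..} t * max 0 (g t)) \<partial>lborel)"
      by (subst emeasure_density) (auto intro!: nn_integral_cong split: split_indicator)
    also have "\<dots> = ennreal (LINT t:{x<..}|lborel. max 0 (g t))"
      unfolding set_lebesgue_integral_def using i by (subst nn_integral_eq_integral) auto
    finally show ?thesis .
  qed
  have "?P = ?N"
  proof (rule measure_eqI_lessThan)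
    fix x
    show "emeasure ?P {x<..} < \<infinity>"
      using part[OF int] by simp
    have si: "set_integrable lborel {x<..} (\<lambda>t. max 0 (f t))" "set_integrable lborel {x<..} (\<lambda>t. max 0 (- f t))"
      unfolding set_integrable_def
      by (rule integrable_mult_indicator; use int in \<open>auto intro!: integrable_max\<close>)+
    have "(LINT t:{x<..}|lborel. f t)
        = (LINT t:{x<..}|lborel. max 0 (f t) - max 0 (- f t))"
      by (intro set_lebesgue_integral_cong) (auto simp: max_def)
    also have "\<dots> = (LINT t:{x<..}|lborel. max 0 (f t)) - (LINT t:{x<..}|lborel. max 0 (- f t))"
      by (rule set_integral_diff(2)[OF si])
    finally show "emeasure ?P {x<..} = emeasure ?N {x<..}"
      using part[OF int] part[of "\<lambda>t. - f t"] int zero[of x] by simp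
  qed auto
  then have "AE t in lborel. ennreal (max 0 (f t)) = ennreal (max 0 (- f t))"
    by (intro sigma_finite_measure.density_unique[OF sigma_finite_lborel]) auto
  then show ?thesis
    by eventually_elim (auto simp: max_def split: if_splits)
qed

lemma AE_zero_of_primitive_zero:
  assumes v: "v absolutely_integrable_on {a..b}" and zero: "\<And>x. x \<in> {a..b} \<Longrightarrow> primitive a v x = 0"
  shows "AE x in lebesgue_on {a..b}. v x = 0"
proof -
  obtain v0 where v0 [measurable]: "v0 \<in> borel_measurable borel" and int: "integrable lborel v0"
    and supp: "\<And>t. t \<notin> {a..b} \<Longrightarrow> v0 t = 0" and eq: "AE t in lebesgue_on {a..b}. v t = v0 t"
    using obtain_borel_representative[OF v] by blast
  have "(LINT t:{x<..}|lborel. v0 t) = 0" for x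
  proof -
    have "(LINT t:{x<..}|lborel. v0 t) = integral {x<..} v0"
      using int by (intro set_borel_integral_eq_integral(2))
        (unfold set_integrable_def, rule integrable_mult_indicator, auto)
    also have "\<dots> = integral {max a x..b} v0"
      by (rule integral_spike_set; rule negligible_subset[of "{x}"]) (use supp in force)+
    also have "\<dots> = integral {max a x..b} v"
      by (rule integral_cong_AE_lebesgue_on[symmetric, OF eq]) auto
    also have "\<dots> = 0"
    proof (cases "max a x \<le> b")
      case True
      have "integral {a..max a x} v + integral {max a x..b} v = integral {a..b} v"
        using True v
        by (intro Henstock_Kurzweil_Integration.integral_combine set_lebesgue_integral_eq_integral(1)) auto
      then show ?thesis
        using zero[of "max a x"] zero[of b] True by (simp add: primitive_def)
    qed simp
    finally show ?thesis .
  qed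
  then have "AE t in lebesgue. v0 t = 0"
    by (intro AE_completion AE_zero_of_half_line_integrals int)
  then have "AE t in lebesgue_on {a..b}. v0 t = 0"
    by (simp add: AE_restrict_space_iff) (auto elim: eventually_mono)
  with eq show ?thesis by eventually_elim simp
qed

lemma AE_eq_of_primitive_eq:
  assumes f: "f absolutely_integrable_on {a..b}" and g: "g absolutely_integrable_on {a..b}"
    and eq: "\<And>x. x \<in> {a..b} \<Longrightarrow> primitive a f x = primitive a g x"
  shows "AE x in lebesgue_on {a..b}. f x = g x"
proof -
  have "AE x in lebesgue_on {a..b}. f x - g x = 0"
  proof (rule AE_zero_of_primitive_zero)
    show "(\<lambda>x. f x - g x) absolutely_integrable_on {a..b}"
      using f g by (rule set_integral_diff(1))
    fix x assume x: "x \<in> {a..b}"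
    have "f absolutely_integrable_on {a..x}" "g absolutely_integrable_on {a..x}"
      using x by (auto intro: set_integrable_subset[OF f] set_integrable_subset[OF g])
    then show "primitive a (\<lambda>x. f x - g x) x = 0"
      using eq[OF x] by (simp add: primitive_def Henstock_Kurzweil_Integration.integral_diff
        set_lebesgue_integral_eq_integral(1))
  qed
  then show ?thesis by eventually_elim simp
qed

section \<open>Smooth functions and test functions\<close>
definition smooth :: "(real \<Rightarrow> real) \<Rightarrow> bool" where
  "smooth f \<longleftrightarrow> (\<forall>k x. ((deriv ^^ k) f) differentiable (at x))"

text \<open>
  This replaces inductions on the order of the derivative: it suffices to exhibit a set of functions
  that is closed under differentiation.
\<close>
lemma smooth_coinduct:
  assumes "f \<in> S" and step: "\<And>g. g \<in> S \<Longrightarrow> \<exists>g'\<in>S. \<forall>x. (g has_real_derivative g' x) (at x)"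
  shows "smooth f"
proof -
  have deriv_S: "deriv g \<in> S" if g: "g \<in> S" for g
  proof -
    obtain g' where "g' \<in> S" "\<forall>x. (g has_real_derivative g' x) (at x)"
      using step[OF g] by blast
    then have "deriv g = g'" by (auto intro!: DERIV_imp_deriv)
    with \<open>g' \<in> S\<close> show ?thesis by simp
  qed
  have "(deriv ^^ k) f \<in> S" for k
    by (induction k) (auto intro: \<open>f \<in> S\<close> deriv_S)
  then show ?thesis
    unfolding smooth_def using step by (meson real_differentiable_def)
qed

lemma smooth_deriv: "smooth f \<Longrightarrow> smooth (deriv f)"
  unfolding smooth_def by (metis funpow_Suc_right o_apply)

lemma smooth_has_deriv: "smooth f \<Longrightarrow> (f has_real_derivative deriv f x) (at x)"
  unfolding smooth_def by (metis DERIV_deriv_iff_real_differentiable funpow_0)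

lemma smooth_imp_continuous_on: "smooth f \<Longrightarrow> continuous_on S f"
  by (intro continuous_at_imp_continuous_on ballI DERIV_isCont[OF smooth_has_deriv])

lemma smooth_antiderivative:
  assumes "smooth f" "\<And>x. (F has_real_derivative f x) (at x)"
  shows "smooth F"
  by (rule smooth_coinduct[where S = "insert F (Collect smooth)"])
     (use assms smooth_deriv smooth_has_deriv in blast)+

text \<open>
  The function \<open>flat 0\<close> is \<open>exp (- 1 / x)\<close> for \<open>x > 0\<close>, extended by zero. The factors \<open>x\<^sup>-\<^sup>k\<close> are there
  because the linear span of all \<open>flat k\<close> is closed under differentiation.
\<close>
definition flat :: "nat \<Rightarrow> real \<Rightarrow> real" where
  "flat k x = (if 0 < x then inverse x ^ k / exp (inverse x) else 0)"

lemma flat_tendsto_0: "(flat k \<longlongrightarrow> 0) (at 0)"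
proof (rule filterlim_split_at)
  show "(flat k \<longlongrightarrow> 0) (at_left 0)"
    by (rule tendsto_eventually) (auto simp: eventually_at_filter flat_def)
  have "((\<lambda>x::real. inverse x ^ k / exp (inverse x)) \<longlongrightarrow> 0) (at_right 0)"
    by (rule filterlim_compose[OF tendsto_power_div_exp_0 filterlim_inverse_at_top_right])
  then show "(flat k \<longlongrightarrow> 0) (at_right 0)"
    by (rule Lim_transform_eventually) (auto simp: eventually_at_filter flat_def)
qed

lemma flat_has_deriv:
  "(flat k has_real_derivative flat (Suc (Suc k)) x - real k * flat (Suc k) x) (at x)"
proof (cases x "0 :: real" rule: linorder_cases)
  case less
  have "((\<lambda>_. 0) has_real_derivative 0) (at x)" by simp
  then have "(flat k has_real_derivative 0) (at x)"
    by (rule has_field_derivative_transform_within_open[where S = "{..<0}"])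
       (use less in \<open>auto simp: flat_def\<close>)
  then show ?thesis using less by (simp add: flat_def)
next
  case equal
  have "((\<lambda>h. flat k h / h) \<longlongrightarrow> 0) (at 0)"
    by (rule Lim_transform_eventually[OF flat_tendsto_0[of "Suc k"]])
       (auto simp: eventually_at_filter flat_def divide_inverse mult_ac)
  then show ?thesis
    using equal by (simp add: has_field_derivative_iff flat_def)
next
  case greater
  have "((\<lambda>y. y ^ k / exp y) has_real_derivative real k * y ^ (k - 1) / exp y - y ^ k / exp y) (at y)"
    for y :: real
    by (auto intro!: derivative_eq_intros simp: field_simps)
  from DERIV_chain2[OF this DERIV_inverse]
  have "((\<lambda>x. inverse x ^ k / exp (inverse x)) has_real_derivative
     (real k * inverse x ^ (k - 1) / exp (inverse x) - inverse x ^ k / exp (inverse x)) *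
       - (inverse x ^ Suc (Suc 0))) (at x)"
    using greater by simp
  also have "(real k * y ^ (k - 1) / exp y - y ^ k / exp y) * - (y ^ Suc (Suc 0))
      = y ^ Suc (Suc k) / exp y - real k * (y ^ Suc k / exp y)" for y :: real
    by (cases k) (simp_all add: field_simps)
  also have "inverse x ^ Suc (Suc k) / exp (inverse x) - real k * (inverse x ^ Suc k / exp (inverse x))
      = flat (Suc (Suc k)) x - real k * flat (Suc k) x"
    using greater by (simp add: flat_def)
  finally have "((\<lambda>x. inverse x ^ k / exp (inverse x)) has_real_derivative
     flat (Suc (Suc k)) x - real k * flat (Suc k) x) (at x)" .
  then show ?thesis
    by (rule has_field_derivative_transform_within_open[where S = "{0<..}"])
       (use greater in \<open>auto simp: flat_def\<close>)
qed

text \<open>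
  The algebra generated by the constants, the smooth functions and the flat functions of affine
  arguments. Since it turns out to consist
  of smooth functions, it gives at once the smoothness of the bumps and the closure of smoothness
  under sums and products.
\<close>
inductive_set smooth_algebra :: "(real \<Rightarrow> real) set" where
  flat: "(\<lambda>x. flat k (c * x + d)) \<in> smooth_algebra"
| smooth: "smooth f \<Longrightarrow> f \<in> smooth_algebra"
| const: "(\<lambda>x. c) \<in> smooth_algebra"
| add: "f \<in> smooth_algebra \<Longrightarrow> g \<in> smooth_algebra \<Longrightarrow> (\<lambda>x. f x + g x) \<in> smooth_algebra"
| mult: "f \<in> smooth_algebra \<Longrightarrow> g \<in> smooth_algebra \<Longrightarrow> (\<lambda>x. f x * g x) \<in> smooth_algebra"

lemma smooth_algebra_deriv:
  assumes "f \<in> smooth_algebra"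
  shows "\<exists>f'\<in>smooth_algebra. \<forall>x. (f has_real_derivative f' x) (at x)"
  using assms
proof induction
  case (flat k c d)
  let ?f = "\<lambda>x. c * (flat (Suc (Suc k)) (c * x + d) + (- real k) * flat (Suc k) (c * x + d))"
  have "?f \<in> smooth_algebra"
    by (intro smooth_algebra.intros)
  moreover have "((\<lambda>x. flat k (c * x + d)) has_real_derivative ?f x) (at x)" for x
  proof -
    have "((\<lambda>x. c * x + d) has_real_derivative c) (at x)"
      by (auto intro!: derivative_eq_intros)
    from DERIV_chain2[OF flat_has_deriv this] show ?thesis
      by (simp add: algebra_simps)
  qed
  ultimately show ?case by (intro bexI[of _ ?f]) auto
next
  case (smooth f)
  then show ?case
    using smooth_deriv smooth_has_deriv smooth_algebra.smooth by blast
next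
  case (const c)
  show ?case
    by (rule bexI[of _ "\<lambda>_. 0"]) (auto intro: smooth_algebra.const)
next
  case (add f g)
  then obtain f' g' where "f' \<in> smooth_algebra" "g' \<in> smooth_algebra"
    "\<forall>x. (f has_real_derivative f' x) (at x)" "\<forall>x. (g has_real_derivative g' x) (at x)" by blast
  then show ?case
    by (intro bexI[of _ "\<lambda>x. f' x + g' x"]) (auto intro: smooth_algebra.add derivative_intros)
next
  case (mult f g)
  then obtain f' g' where "f' \<in> smooth_algebra" "g' \<in> smooth_algebra"
    "\<forall>x. (f has_real_derivative f' x) (at x)" "\<forall>x. (g has_real_derivative g' x) (at x)" by blast
  then show ?case using mult(1,2)
    by (intro bexI[of _ "\<lambda>x. f' x * g x + g' x * f x"])
       (auto intro: smooth_algebra.intros intro!: derivative_eq_intros)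
qed

lemma smooth_algebra_imp_smooth: "f \<in> smooth_algebra \<Longrightarrow> smooth f"
  by (rule smooth_coinduct[OF _ smooth_algebra_deriv])

lemma test_fun_imp_smooth: "test_fun a b \<psi> \<Longrightarrow> smooth \<psi>"
  by (simp add: test_fun_def smooth_def)

text \<open>
  A compact subset of \<open>(a, b)\<close> lies between its extreme points. Intervals are easier to combine than
  closures of supports.
\<close>
lemma test_fun_iff:
  assumes "a < b"
  shows "test_fun a b \<psi> \<longleftrightarrow>
    smooth \<psi> \<and> (\<exists>c d. a < c \<and> c \<le> d \<and> d < b \<and> (\<forall>x. x \<notin> {c..d} \<longrightarrow> \<psi> x = 0))"
proof
  assume L: "test_fun a b \<psi>"
  let ?K = "closure {x. \<psi> x \<noteq> 0}"
  have sub: "?K \<subseteq> {a<..<b}" using L by (simp add: test_fun_def)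
  have "\<exists>c d. a < c \<and> c \<le> d \<and> d < b \<and> (\<forall>x. x \<notin> {c..d} \<longrightarrow> \<psi> x = 0)"
  proof (cases "?K = {}")
    case True
    then have "\<psi> x = 0" for x by simp
    then show ?thesis
      using assms dense[OF assms] by force
  next
    case False
    have "bounded ?K" by (rule bounded_subset[OF _ sub]) simp
    then have K: "compact ?K" by (simp add: compact_eq_bounded_closed)
    obtain c where c: "c \<in> ?K" "\<And>x. x \<in> ?K \<Longrightarrow> c \<le> x"
      using compact_attains_inf[OF K False] by blast
    obtain d where d: "d \<in> ?K" "\<And>x. x \<in> ?K \<Longrightarrow> x \<le> d"
      using compact_attains_sup[OF K False] by blast
    have "\<psi> x = 0" if "x \<notin> {c..d}" for x
      using that c(2)[of x] d(2)[of x] closure_subset[of "{x. \<psi> x \<noteq> 0}"] by force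
    moreover have "a < c" "d < b" using c(1) d(1) sub by auto
    moreover have "c \<le> d" using c d by blast
    ultimately show ?thesis by blast
  qed
  with L show "smooth \<psi> \<and> (\<exists>c d. a < c \<and> c \<le> d \<and> d < b \<and> (\<forall>x. x \<notin> {c..d} \<longrightarrow> \<psi> x = 0))"
    by (simp add: test_fun_imp_smooth)
next
  assume "smooth \<psi> \<and> (\<exists>c d. a < c \<and> c \<le> d \<and> d < b \<and> (\<forall>x. x \<notin> {c..d} \<longrightarrow> \<psi> x = 0))"
  then obtain c d where s: "smooth \<psi>" and cd: "a < c" "d < b" "\<And>x. x \<notin> {c..d} \<Longrightarrow> \<psi> x = 0"
    by blast
  have "closure {x. \<psi> x \<noteq> 0} \<subseteq> {c..d}"
    using cd(3) by (intro closure_minimal) blast+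
  with cd(1,2) have "closure {x. \<psi> x \<noteq> 0} \<subseteq> {a<..<b}"
    by force
  with s show "test_fun a b \<psi>" by (simp add: test_fun_def smooth_def)
qed

lemma test_fun_deriv:
  assumes "test_fun a b \<psi>"
  shows "test_fun a b (deriv \<psi>)"
proof -
  have "deriv \<psi> x = 0" if x: "x \<notin> closure {x. \<psi> x \<noteq> 0}" for x
  proof -
    have "((\<lambda>_. 0) has_real_derivative 0) (at x)" by simp
    then have "(\<psi> has_real_derivative 0) (at x)"
    proof (rule has_field_derivative_transform_within_open)
      show "open (- closure {x. \<psi> x \<noteq> 0})" by auto
      show "0 = \<psi> y" if "y \<in> - closure {x. \<psi> x \<noteq> 0}" for y
        using that closure_subset[of "{x. \<psi> x \<noteq> 0}"] by auto
    qed (use x in auto)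
    then show ?thesis by (rule DERIV_imp_deriv)
  qed
  then have "closure {x. deriv \<psi> x \<noteq> 0} \<subseteq> closure {x. \<psi> x \<noteq> 0}"
    by (intro closure_minimal) auto
  with assms show ?thesis
    using smooth_deriv[OF test_fun_imp_smooth[OF assms]] by (auto simp: test_fun_def smooth_def)
qed

lemma test_fun_deriv_funpow: "test_fun a b \<psi> \<Longrightarrow> test_fun a b ((deriv ^^ k) \<psi>)"
  by (induction k) (auto intro: test_fun_deriv)

text \<open>
  On \<open>(c, d)\<close> this is \<open>exp (- (1 / (x - c) + 1 / (d - x)) / (i + 1))\<close>, a root of a fixed bump. As
  \<open>i\<close> grows it tends to the indicator of \<open>(c, d)\<close> while staying between \<open>0\<close> and \<open>1\<close>, so indicators
  are limits of test functions by dominated convergence, without mollifiers.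
\<close>
definition bump :: "real \<Rightarrow> real \<Rightarrow> nat \<Rightarrow> real \<Rightarrow> real" where
  "bump c d i x = flat 0 (real (Suc i) * (x - c)) * flat 0 (real (Suc i) * (d - x))"

lemma bump_nonneg: "0 \<le> bump c d i x"
  by (simp add: bump_def flat_def)

lemma bump_le_1: "bump c d i x \<le> 1"
proof -
  have "flat 0 y \<le> 1" "0 \<le> flat 0 y" for y by (auto simp: flat_def)
  then show ?thesis unfolding bump_def by (intro mult_le_one) auto
qed

lemma bump_eq_0_iff: "bump c d i x = 0 \<longleftrightarrow> x \<notin> {c<..<d}"
  by (auto simp: bump_def flat_def zero_less_mult_iff)

lemma smooth_bump: "smooth (bump c d i)"
proof -
  have "(\<lambda>x. flat 0 (real (Suc i) * x + (- (real (Suc i) * c))) * flat 0 ((- real (Suc i)) * x + real (Suc i) * d))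
    \<in> smooth_algebra"
    by (intro smooth_algebra.intros)
  also have "(\<lambda>x. flat 0 (real (Suc i) * x + (- (real (Suc i) * c))) * flat 0 ((- real (Suc i)) * x + real (Suc i) * d))
    = bump c d i"
    by (auto simp: bump_def algebra_simps)
  finally show ?thesis by (rule smooth_algebra_imp_smooth)
qed

lemma test_fun_bump:
  assumes "a < c" "c < d" "d < b"
  shows "test_fun a b (bump c d i)"
proof -
  have "bump c d i x = 0" if "x \<notin> {c..d}" for x
    using that by (subst bump_eq_0_iff) auto
  with assms have "\<exists>c' d'. a < c' \<and> c' \<le> d' \<and> d' < b \<and> (\<forall>x. x \<notin> {c'..d'} \<longrightarrow> bump c d i x = 0)"
    by (intro exI[of _ c] exI[of _ d]) (auto simp del: atLeastAtMost_iff)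
  then show ?thesis
    using assms smooth_bump by (subst test_fun_iff) auto
qed

lemma bump_tendsto: "(\<lambda>i. bump c d i x) \<longlonglongrightarrow> indicator {c<..<d} x"
proof (cases "x \<in> {c<..<d}")
  case False
  then show ?thesis by (simp add: bump_eq_0_iff[THEN iffD2])
next
  case True
  have "(\<lambda>i. flat 0 (real (Suc i) * y)) \<longlonglongrightarrow> 1" if "0 < y" for y
  proof -
    have "(\<lambda>i. 1 / exp (inverse (real (Suc i)) * inverse y)) \<longlonglongrightarrow> 1 / exp (0 * inverse y)"
      by (intro tendsto_intros LIMSEQ_inverse_real_of_nat) auto
    then show ?thesis using that by (simp add: flat_def)
  qed
  from this[of "x - c"] this[of "d - x"] True
  have "(\<lambda>i. bump c d i x) \<longlonglongrightarrow> 1 * 1"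
    unfolding bump_def by (intro tendsto_mult) auto
  with True show ?thesis by simp
qed

section \<open>The lemmas of the calculus of variations\<close>
lemma absolutely_integrable_mult_continuous:
  fixes v \<psi> :: "real \<Rightarrow> real"
  assumes "v absolutely_integrable_on {a..b}" "continuous_on {a..b} \<psi>"
  shows "(\<lambda>x. v x * \<psi> x) absolutely_integrable_on {a..b}"
proof -
  have "(\<lambda>x. \<psi> x * v x) absolutely_integrable_on {a..b}"
    using assms
    by (intro absolutely_integrable_bounded_measurable_product_real)
       (auto intro: continuous_imp_measurable_on_sets_lebesgue compact_imp_bounded compact_continuous_image)
  then show ?thesis by (simp add: mult.commute)
qed

lemma set_lebesgue_integral_Ioo_eq_integral:
  fixes f :: "real \<Rightarrow> real"
  assumes "f absolutely_integrable_on {a..b}"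
  shows "(LINT x:{a<..<b}|lebesgue. f x) = integral {a..b} f"
proof -
  have "f absolutely_integrable_on {a<..<b}"
    by (rule set_integrable_subset[OF assms]) auto
  then show ?thesis
    by (simp add: set_lebesgue_integral_eq_integral(2) integral_open_interval_real)
qed

lemma continuous_eq_of_AE_eq:
  fixes f g :: "real \<Rightarrow> real"
  assumes "a < b" "continuous_on {a..b} f" "continuous_on {a..b} g"
    and ae: "AE x in lebesgue_on {a..b}. f x = g x" and "x \<in> {a..b}"
  shows "f x = g x"
proof -
  have "integral {a..b} (\<lambda>x. \<bar>f x - g x\<bar>) = integral {a..b} (\<lambda>x. 0)"
    by (rule integral_cong_AE_lebesgue_on[where a = a and b = b]) (use ae in \<open>auto elim: eventually_mono\<close>)
  then have "\<forall>x\<in>{a..b}. \<bar>f x - g x\<bar> = 0"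
    using assms by (subst integral_eq_0_iff[symmetric]) (auto intro!: continuous_intros)
  with \<open>x \<in> {a..b}\<close> show ?thesis by auto
qed

text \<open>
  Testing against bumps shows that \<open>v\<close> has integral zero over every interval inside \<open>(a, b)\<close>. Its
  primitive is then constant on \<open>(a, b)\<close>, hence zero on \<open>{a..b}\<close> by continuity.
\<close>
lemma fundamental_lemma_calculus_of_variations:
  fixes v :: "real \<Rightarrow> real"
  assumes "a < b" and v: "v absolutely_integrable_on {a..b}"
    and zero: "\<And>\<psi>. test_fun a b \<psi> \<Longrightarrow> integral {a..b} (\<lambda>x. v x * \<psi> x) = 0"
  shows "AE x in lebesgue_on {a..b}. v x = 0"
proof -
  have v_int: "v integrable_on {a..b}"
    using v by (rule set_lebesgue_integral_eq_integral(1))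
  have inner: "integral {c..d} v = 0" if cd: "a < c" "c < d" "d < b" for c d
  proof -
    have "(\<lambda>i. integral {a..b} (\<lambda>x. v x * bump c d i x)) \<longlonglongrightarrow>
        integral {a..b} (\<lambda>x. v x * indicator {c<..<d} x)"
    proof (rule dominated_convergence(2))
      show "(\<lambda>x. v x * bump c d i x) integrable_on {a..b}" for i
        by (intro set_lebesgue_integral_eq_integral(1) absolutely_integrable_mult_continuous v
          smooth_imp_continuous_on smooth_bump)
      show "(\<lambda>x. \<bar>v x\<bar>) integrable_on {a..b}"
        using set_integrable_abs[OF v] by (rule set_lebesgue_integral_eq_integral(1))
      show "norm (v x * bump c d i x) \<le> \<bar>v x\<bar>" for i x
        using bump_nonneg[of c d i x] bump_le_1[of c d i x] by (simp add: abs_mult mult_left_le)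
      show "(\<lambda>i. v x * bump c d i x) \<longlonglongrightarrow> v x * indicator {c<..<d} x" for x
        by (intro tendsto_intros bump_tendsto)
    qed
    then have "integral {a..b} (\<lambda>x. v x * indicator {c<..<d} x) = 0"
      using zero[OF test_fun_bump[OF cd]] by (simp add: LIMSEQ_const_iff)
    also have "(\<lambda>x. v x * indicator {c<..<d} x) = (\<lambda>x. if x \<in> {c<..<d} then v x else 0)"
      by (auto simp: indicator_def)
    also have "integral {a..b} \<dots> = integral ({a..b} \<inter> {c<..<d}) v"
      by (simp only: integral_restrict_Int Int_commute)
    also have "{a..b} \<inter> {c<..<d} = {c<..<d}" using cd by auto
    finally show ?thesis by (simp add: integral_open_interval_real)
  qed
  have cont: "continuous_on {a..b} (primitive a v)"
    using v by (rule continuous_on_primitive)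
  define e where "e = (a + b) / 2"
  have e: "a < e" "e < b" using \<open>a < b\<close> by (auto simp: e_def)
  have diff: "primitive a v y - primitive a v x = integral {x..y} v" if "a \<le> x" "x \<le> y" "y \<le> b" for x y
  proof -
    have "integral {a..x} v + integral {x..y} v = integral {a..y} v"
      using that by (intro Henstock_Kurzweil_Integration.integral_combine
        integrable_on_subinterval[OF v_int]) auto
    then show ?thesis by (simp add: primitive_def)
  qed
  have const: "primitive a v x = primitive a v e" if "x \<in> {a..b}" for x
  proof (rule continuous_constant_on_closure[where S = "{a<..<b}" and f = "primitive a v"])
    show "continuous_on (closure {a<..<b}) (primitive a v)"
      using cont \<open>a < b\<close> by simp
    show "x \<in> closure {a<..<b}" using that \<open>a < b\<close> by simp
    fix y assume y: "y \<in> {a<..<b}"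
    show "primitive a v y = primitive a v e"
      using diff[of y e] diff[of e y] inner[of y e] inner[of e y] y e
      by (cases y e rule: linorder_cases) auto
  qed
  have "primitive a v x = 0" if "x \<in> {a..b}" for x
    using const[OF that] const[of a] \<open>a < b\<close> by simp
  then show ?thesis by (rule AE_zero_of_primitive_zero[OF v])
qed

text \<open>
  An antiderivative of \<open>\<omega>\<close> is constant on either side of the support of \<open>\<omega>\<close>; the vanishing
  integral makes the two constants equal, so both can be normalised to zero.
\<close>
lemma test_fun_antiderivative:
  assumes "a < b" and \<omega>: "test_fun a b \<omega>" and zero: "integral {a..b} \<omega> = 0"
  obtains \<psi> where "test_fun a b \<psi>" "deriv \<psi> = \<omega>"
proof -
  have s: "smooth \<omega>" using \<omega> by (rule test_fun_imp_smooth)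
  obtain c d where cd: "a < c" "c \<le> d" "d < b" and supp: "\<And>x. x \<notin> {c..d} \<Longrightarrow> \<omega> x = 0"
    using \<omega> test_fun_iff[OF \<open>a < b\<close>] by blast
  have "isCont \<omega> x" for x
    using smooth_imp_continuous_on[OF s, of UNIV] by (simp add: continuous_on_eq_continuous_at)
  then have "\<exists>F. \<forall>x::real. -\<infinity> < ereal x \<longrightarrow> ereal x < \<infinity> \<longrightarrow> (F has_vector_derivative \<omega> x) (at x)"
    by (intro einterval_antiderivative) auto
  then obtain F where F: "(F has_real_derivative \<omega> x) (at x)" for x
    by (auto simp: has_real_derivative_iff_has_vector_derivative)
  define \<psi> where "\<psi> x = F x - F a" for x
  have \<psi>: "(\<psi> has_real_derivative \<omega> x) (at x)" for x
    unfolding \<psi>_def by (auto intro!: derivative_eq_intros F)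
  have cont: "continuous_on S \<psi>" for S
    by (intro continuous_at_imp_continuous_on ballI DERIV_isCont[OF \<psi>])
  have const: "\<psi> x = \<psi> y" if "x < y" and z: "\<And>z. x < z \<Longrightarrow> z < y \<Longrightarrow> \<omega> z = 0" for x y
  proof (rule DERIV_isconst_end[OF \<open>x < y\<close> cont, symmetric])
    show "(\<psi> has_real_derivative 0) (at u)" if "x < u" "u < y" for u
      using \<psi>[of u] z[OF that] by simp
  qed
  have "(\<omega> has_integral (\<psi> b - \<psi> a)) {a..b}"
    using \<open>a < b\<close> \<psi> by (intro fundamental_theorem_of_calculus)
      (auto simp: has_real_derivative_iff_has_vector_derivative intro: has_vector_derivative_at_within)
  with zero have "\<psi> b = \<psi> a" by (auto dest: integral_unique)
  then have ab: "\<psi> a = 0" "\<psi> b = 0" by (auto simp: \<psi>_def)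
  have "\<psi> x = 0" if "x \<notin> {c..d}" for x
  proof (cases "x < c")
    case True
    have z: "\<omega> z = 0" if "z < c" for z using that by (intro supp) auto
    have "\<psi> x = \<psi> a"
    proof (cases x a rule: linorder_cases)
      case less
      then show ?thesis by (rule const) (use z cd(1) in simp)
    next
      case greater
      then show ?thesis by (rule const[symmetric]) (use z True in simp)
    qed simp
    with ab show ?thesis by simp
  next
    case False
    with that have "d < x" by auto
    have z: "\<omega> z = 0" if "d < z" for z using that by (intro supp) auto
    have "\<psi> x = \<psi> b"
    proof (cases x b rule: linorder_cases)
      case less
      then show ?thesis by (rule const) (use z \<open>d < x\<close> in simp)
    next
      case greater
      then show ?thesis by (rule const[symmetric]) (use z cd(3) in simp)
    qed simp
    with ab show ?thesis by simp
  qed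
  then have "test_fun a b \<psi>"
    using smooth_antiderivative[OF s \<psi>] cd by (subst test_fun_iff[OF \<open>a < b\<close>]) blast
  moreover have "deriv \<psi> = \<omega>" using \<psi> by (auto intro!: DERIV_imp_deriv)
  ultimately show ?thesis by (rule that)
qed

lemma test_fun_diff_scaled:
  assumes "a < b" "test_fun a b \<phi>" "test_fun a b \<eta>"
  shows "test_fun a b (\<lambda>x. \<phi> x - r * \<eta> x)"
proof -
  obtain c d where 1: "a < c" "c \<le> d" "d < b" "\<And>x. x \<notin> {c..d} \<Longrightarrow> \<phi> x = 0"
    using assms test_fun_iff[OF \<open>a < b\<close>] by blast
  obtain c' d' where 2: "a < c'" "c' \<le> d'" "d' < b" "\<And>x. x \<notin> {c'..d'} \<Longrightarrow> \<eta> x = 0"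
    using assms test_fun_iff[OF \<open>a < b\<close>] by blast
  have "(\<lambda>x. \<phi> x + (- r) * \<eta> x) \<in> smooth_algebra"
    using assms by (intro smooth_algebra.add smooth_algebra.mult smooth_algebra.const
      smooth_algebra.smooth[OF test_fun_imp_smooth])
  then have "smooth (\<lambda>x. \<phi> x - r * \<eta> x)"
    using smooth_algebra_imp_smooth by fastforce
  moreover have "\<phi> x - r * \<eta> x = 0" if "x \<notin> {min c c'..max d d'}" for x
  proof -
    have "x \<notin> {c..d}" "x \<notin> {c'..d'}" using that by auto
    then show ?thesis using 1(4) 2(4) by simp
  qed
  moreover have "a < min c c'" "min c c' \<le> max d d'" "max d d' < b" using 1 2 by auto
  ultimately show ?thesis by (subst test_fun_iff[OF \<open>a < b\<close>]) blast
qed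

text \<open>
  Fix a test function \<open>\<eta>\<close> with nonzero integral. By subtracting a multiple of \<open>\<eta>\<close>, any test function
  \<open>\<phi>\<close> becomes the derivative of a test function. So the integral of \<open>v \<phi>\<close> depends on \<open>\<phi>\<close> only through
  its integral, as it would for a constant \<open>C\<close>, and the fundamental lemma applies to \<open>v - C\<close>.
\<close>
lemma du_Bois_Reymond:
  fixes v :: "real \<Rightarrow> real"
  assumes "a < b" and v: "v absolutely_integrable_on {a..b}"
    and zero: "\<And>\<psi>. test_fun a b \<psi> \<Longrightarrow> integral {a..b} (\<lambda>x. v x * deriv \<psi> x) = 0"
  obtains C where "AE x in lebesgue_on {a..b}. v x = C"
proof -
  define c d \<eta> where "c = (2 * a + b) / 3" and "d = (a + 2 * b) / 3" and "\<eta> = bump c d 0"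
  have cd: "a < c" "c < d" "d < b" using \<open>a < b\<close> by (auto simp: c_def d_def)
  have \<eta>: "test_fun a b \<eta>" unfolding \<eta>_def by (rule test_fun_bump[OF cd])
  have tf_cont: "continuous_on S \<psi>" if "test_fun a b \<psi>" for S \<psi>
    using that by (intro smooth_imp_continuous_on test_fun_imp_smooth)
  have tf_int: "\<psi> integrable_on {a..b}" if "test_fun a b \<psi>" for \<psi>
    using tf_cont[OF that] by (rule integrable_continuous_real)
  have v_tf_int: "(\<lambda>x. v x * \<psi> x) integrable_on {a..b}" if "test_fun a b \<psi>" for \<psi>
    by (intro set_lebesgue_integral_eq_integral(1) absolutely_integrable_mult_continuous v tf_cont[OF that])
  \<comment> \<open>A nonnegative continuous function with a positive value has nonzero integral.\<close>
  have "(c + d) / 2 \<in> {a..b}" "\<eta> ((c + d) / 2) \<noteq> 0"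
    using cd by (auto simp: \<eta>_def bump_eq_0_iff)
  then have I\<eta>: "integral {a..b} \<eta> \<noteq> 0"
    using \<open>a < b\<close> tf_cont[OF \<eta>] bump_nonneg by (subst integral_eq_0_iff) (auto simp: \<eta>_def)
  define C where "C = integral {a..b} (\<lambda>x. v x * \<eta> x) / integral {a..b} \<eta>"
  have "AE x in lebesgue_on {a..b}. v x - C = 0"
  proof (rule fundamental_lemma_calculus_of_variations[OF \<open>a < b\<close>])
    show "(\<lambda>x. v x - C) absolutely_integrable_on {a..b}"
      by (rule set_integral_diff(1)[OF v]) (auto intro: absolutely_integrable_continuous_real)
    fix \<phi> assume \<phi>: "test_fun a b \<phi>"
    define r where "r = integral {a..b} \<phi> / integral {a..b} \<eta>"
    have "test_fun a b (\<lambda>x. \<phi> x - r * \<eta> x)"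
      by (rule test_fun_diff_scaled[OF \<open>a < b\<close> \<phi> \<eta>])
    moreover have "integral {a..b} (\<lambda>x. \<phi> x - r * \<eta> x) = integral {a..b} \<phi> - r * integral {a..b} \<eta>"
      using tf_int[OF \<phi>] tf_int[OF \<eta>]
      by (subst Henstock_Kurzweil_Integration.integral_diff) (auto intro: integrable_on_mult_right)
    then have "integral {a..b} (\<lambda>x. \<phi> x - r * \<eta> x) = 0"
      using I\<eta> by (simp add: r_def)
    ultimately obtain \<psi> where "test_fun a b \<psi>" "deriv \<psi> = (\<lambda>x. \<phi> x - r * \<eta> x)"
      using test_fun_antiderivative[OF \<open>a < b\<close>] by blast
    then have "0 = integral {a..b} (\<lambda>x. v x * (\<phi> x - r * \<eta> x))"
      using zero by metis
    also have "\<dots> = integral {a..b} (\<lambda>x. v x * \<phi> x - r * (v x * \<eta> x))"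
      by (simp add: algebra_simps)
    also have "\<dots> = integral {a..b} (\<lambda>x. v x * \<phi> x) - r * integral {a..b} (\<lambda>x. v x * \<eta> x)"
      using v_tf_int[OF \<phi>] v_tf_int[OF \<eta>]
      by (subst Henstock_Kurzweil_Integration.integral_diff) (auto intro: integrable_on_mult_right)
    also have "r * integral {a..b} (\<lambda>x. v x * \<eta> x) = C * integral {a..b} \<phi>"
      by (simp add: r_def C_def)
    also have "integral {a..b} (\<lambda>x. v x * \<phi> x) - C * integral {a..b} \<phi>
      = integral {a..b} (\<lambda>x. v x * \<phi> x - C * \<phi> x)"
      using v_tf_int[OF \<phi>] tf_int[OF \<phi>]
      by (subst Henstock_Kurzweil_Integration.integral_diff) (auto intro: integrable_on_mult_right)
    finally show "integral {a..b} (\<lambda>x. (v x - C) * \<phi> x) = 0"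
      by (simp add: algebra_simps)
  qed
  then show ?thesis by (intro that[of C]) (auto elim: eventually_mono)
qed

text \<open>
  Integration by parts for a primitive that need not be differentiable everywhere: exchange the order
  of integration over the triangle \<open>s < x\<close> and integrate \<open>deriv \<psi>\<close> over \<open>(s, b)\<close>.
\<close>
lemma integral_primitive_mult_deriv:
  assumes "a < b" and v: "v absolutely_integrable_on {a..b}" and \<psi>: "smooth \<psi>" and "\<psi> b = 0"
  shows "integral {a..b} (\<lambda>x. primitive a v x * deriv \<psi> x) = - integral {a..b} (\<lambda>x. v x * \<psi> x)"
proof -
  obtain v0 where v0 [measurable]: "v0 \<in> borel_measurable borel" and int: "integrable lborel v0"
    and supp: "\<And>t. t \<notin> {a..b} \<Longrightarrow> v0 t = 0" and eq: "AE t in lebesgue_on {a..b}. v t = v0 t"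
    using obtain_borel_representative[OF v] by blast
  have cont: "continuous_on S (deriv \<psi>)" for S
    using \<psi> by (intro smooth_imp_continuous_on smooth_deriv)
  have [measurable]: "\<psi> \<in> borel_measurable borel" "deriv \<psi> \<in> borel_measurable borel"
    using \<psi> by (auto intro!: borel_measurable_continuous_onI smooth_imp_continuous_on smooth_deriv)
  define f where "f x s = (indicator {a..b} x * deriv \<psi> x) * (rl_kernel 1 (b - x) * (rl_kernel 1 (x - s) * v0 s))"
    for x s :: real
  have "bounded (deriv \<psi> ` {a..b})"
    by (intro compact_imp_bounded compact_continuous_image cont) auto
  then obtain M where "0 < M" and M': "\<forall>y\<in>deriv \<psi> ` {a..b}. norm y \<le> M"
    unfolding bounded_pos by blast
  have M: "\<bar>deriv \<psi> x\<bar> \<le> M" if "x \<in> {a..b}" for x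
    using M' that by auto
  have pair: "integrable (lborel \<Otimes>\<^sub>M lborel) (\<lambda>(x, s). f x s)"
  proof (rule Bochner_Integration.integrable_bound)
    show "integrable (lborel \<Otimes>\<^sub>M lborel) (\<lambda>z. M * (case z of (x, s) \<Rightarrow> rl_kernel 1 (b - x) * (rl_kernel 1 (x - s) * v0 s)))"
      using supp by (intro integrable_mult_right rl_kernel_pair_integrable integrable_rl_kernel_bounded[of _ _ a] int) auto
    have "\<bar>f x s\<bar> \<le> \<bar>M * (rl_kernel 1 (b - x) * (rl_kernel 1 (x - s) * v0 s))\<bar>" for x s
      unfolding f_def abs_mult using M[of x] \<open>0 < M\<close>
      by (intro mult_right_mono) (auto simp: indicator_def)
    then show "AE z in lborel \<Otimes>\<^sub>M lborel. norm (case z of (x, s) \<Rightarrow> f x s)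
       \<le> norm (M * (case z of (x, s) \<Rightarrow> rl_kernel 1 (b - x) * (rl_kernel 1 (x - s) * v0 s)))"
      by auto
  qed (unfold f_def, measurable)
  have inner_s: "(\<integral> s. f x s \<partial>lborel) =
      (if x \<in> {a..b} then rl_kernel 1 (b - x) * (primitive a v x * deriv \<psi> x) else 0)" for x
  proof (cases "x \<in> {a..b}")
    case True
    have "primitive a v x = (\<integral> s. rl_kernel 1 (x - s) * v0 s \<partial>lborel)"
      using RL_integral_1[OF v True] RL_integral_eq_convolution[OF v v0 supp eq] True by simp
    then show ?thesis using True by (simp add: f_def)
  qed (auto simp: f_def)
  have inner_x: "(\<integral> x. f x s \<partial>lborel) = (if s \<in> {a..b} then - (v0 s * \<psi> s) else 0)" for s
  proof (cases "s \<in> {a..b}")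
    case True
    have "f x s = v0 s * (indicator {s<..<b} x *\<^sub>R deriv \<psi> x)" for x
      using True by (auto simp: f_def indicator_def rl_kernel_def)
    then have "(\<integral> x. f x s \<partial>lborel) = v0 s * (LINT x:{s<..<b}|lborel. deriv \<psi> x)"
      by (simp add: set_lebesgue_integral_def)
    also have "(LINT x:{s<..<b}|lborel. deriv \<psi> x) = integral {s<..<b} (deriv \<psi>)"
    proof (rule set_borel_integral_eq_integral(2))
      have "set_integrable lborel {s..b} (deriv \<psi>)"
        by (rule borel_integrable_atLeastAtMost') (rule cont)
      then show "set_integrable lborel {s<..<b} (deriv \<psi>)"
        by (rule set_integrable_subset) auto
    qed
    also have "\<dots> = integral {s..b} (deriv \<psi>)"
      by (simp add: integral_open_interval_real)
    also have "\<dots> = \<psi> b - \<psi> s"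
      using True smooth_has_deriv[OF \<psi>] by (intro integral_unique fundamental_theorem_of_calculus)
        (auto simp: has_real_derivative_iff_has_vector_derivative intro: has_vector_derivative_at_within)
    finally show ?thesis using True \<open>\<psi> b = 0\<close> by simp
  qed (auto simp: f_def supp)
  have "integral {a..b} (\<lambda>x. primitive a v x * deriv \<psi> x)
      = integral {a..b} (\<lambda>x. rl_kernel 1 (b - x) * (primitive a v x * deriv \<psi> x))"
    by (rule integral_spike[where S = "{b}"]) (auto simp: rl_kernel_1)
  also have "\<dots> = integral UNIV (\<lambda>x. \<integral> s. f x s \<partial>lborel)"
    unfolding inner_s by (simp only: integral_restrict_UNIV)
  also have "\<dots> = (\<integral> x. (\<integral> s. f x s \<partial>lborel) \<partial>lborel)"
    using lborel_pair.integrable_fst[OF pair] by (intro integral_lborel) simp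
  also have "\<dots> = (\<integral> s. (\<integral> x. f x s \<partial>lborel) \<partial>lborel)"
    using lborel_pair.Fubini_integral[OF pair] by simp
  also have "\<dots> = integral UNIV (\<lambda>s. \<integral> x. f x s \<partial>lborel)"
    using lborel_pair.integrable_snd[OF pair] by (intro integral_lborel[symmetric]) simp
  also have "\<dots> = integral {a..b} (\<lambda>s. - (v0 s * \<psi> s))"
    unfolding inner_x by (simp only: integral_restrict_UNIV)
  also have "\<dots> = integral {a..b} (\<lambda>s. - (v s * \<psi> s))"
    by (rule integral_cong_AE_lebesgue_on[where a = a and b = b]) (use eq in \<open>auto elim: eventually_mono\<close>)
  finally show ?thesis by simp
qed

section \<open>Weak derivatives\<close>
lemma absolutely_integrable_imp_locally_integrable:
  assumes "f absolutely_integrable_on {a..b}"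
  shows "locally_integrable_on f {a<..<b}"
  unfolding locally_integrable_on_def
proof safe
  fix K assume "compact K" "K \<subseteq> {a<..<b}"
  then show "f absolutely_integrable_on K"
    by (intro set_integrable_subset[OF assms]) (auto intro: lmeasurable_compact fmeasurableD)
qed

text \<open>
  For functions integrable on all of \<open>{a..b}\<close> the pairings with test functions become gauge integrals
  over \<open>{a..b}\<close>, which do not change under modification on a null set and are linear.
\<close>
lemma has_weak_deriv_iff:
  assumes f: "f absolutely_integrable_on {a..b}" and g: "g absolutely_integrable_on {a..b}"
  shows "has_weak_deriv a b k f g \<longleftrightarrow> (\<forall>\<phi>. test_fun a b \<phi> \<longrightarrow>
    integral {a..b} (\<lambda>x. f x * (deriv ^^ k) \<phi> x) = (- 1) ^ k * integral {a..b} (\<lambda>x. g x * \<phi> x))"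
proof -
  have eq: "(LINT x:{a<..<b}|lebesgue. h x * \<phi> x) = integral {a..b} (\<lambda>x. h x * \<phi> x)"
    if "h absolutely_integrable_on {a..b}" "test_fun a b \<phi>" for h \<phi>
    by (intro set_lebesgue_integral_Ioo_eq_integral absolutely_integrable_mult_continuous that
      smooth_imp_continuous_on test_fun_imp_smooth[OF that(2)])
  show ?thesis
    unfolding has_weak_deriv_def
    using absolutely_integrable_imp_locally_integrable[OF f] absolutely_integrable_imp_locally_integrable[OF g]
    by (simp add: eq f g test_fun_deriv_funpow)
qed

lemma has_weak_deriv_cong_AE:
  assumes f: "f absolutely_integrable_on {a..b}" and g: "g absolutely_integrable_on {a..b}"
    and ff: "AE x in lebesgue_on {a..b}. f x = f' x" and gg: "AE x in lebesgue_on {a..b}. g x = g' x"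
    and wd: "has_weak_deriv a b k f g"
  shows "has_weak_deriv a b k f' g'"
proof -
  have f': "f' absolutely_integrable_on {a..b}" and g': "g' absolutely_integrable_on {a..b}"
    using absolutely_integrable_cong_AE f g ff gg by blast+
  have eq: "integral {a..b} (\<lambda>x. h x * \<psi> x) = integral {a..b} (\<lambda>x. h' x * \<psi> x)"
    if "AE x in lebesgue_on {a..b}. h x = h' x" for h h' \<psi> :: "real \<Rightarrow> real"
    by (rule integral_cong_AE_lebesgue_on[where a = a and b = b]) (use that in \<open>auto elim: eventually_mono\<close>)
  show ?thesis
    using wd unfolding has_weak_deriv_iff[OF f g] has_weak_deriv_iff[OF f' g'] eq[OF ff] eq[OF gg] .
qed

lemma has_weak_deriv_trans:
  assumes "has_weak_deriv a b j f g" "has_weak_deriv a b k g h"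
  shows "has_weak_deriv a b (j + k) f h"
  using assms unfolding has_weak_deriv_def
  by (simp add: funpow_add test_fun_deriv_funpow power_add)

text \<open>
  Test \<open>g\<close> against the derivative of order \<open>k\<close> of \<open>\<phi>\<close> and move the \<open>j\<close> derivatives back to \<open>f\<close>. Since
  weak derivatives of every order are defined directly from \<open>f\<close>, this is what links consecutive orders.
\<close>
lemma has_weak_deriv_cancel:
  assumes "has_weak_deriv a b j f g" "has_weak_deriv a b (j + k) f h"
  shows "has_weak_deriv a b k g h"
  unfolding has_weak_deriv_def
proof (intro conjI allI impI)
  show "locally_integrable_on g {a<..<b}" "locally_integrable_on h {a<..<b}"
    using assms by (auto simp: has_weak_deriv_def)
  fix \<phi> assume \<phi>: "test_fun a b \<phi>"
  have "(- 1) ^ j * (LINT x:{a<..<b}|lebesgue. g x * (deriv ^^ k) \<phi> x)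
      = (LINT x:{a<..<b}|lebesgue. f x * (deriv ^^ (j + k)) \<phi> x)"
    using assms(1) test_fun_deriv_funpow[OF \<phi>, of k] by (simp add: has_weak_deriv_def funpow_add)
  also have "\<dots> = (- 1) ^ (j + k) * (LINT x:{a<..<b}|lebesgue. h x * \<phi> x)"
    using assms(2) \<phi> by (simp add: has_weak_deriv_def)
  finally show "(LINT x:{a<..<b}|lebesgue. g x * (deriv ^^ k) \<phi> x)
      = (- 1) ^ k * (LINT x:{a<..<b}|lebesgue. h x * \<phi> x)"
    by (simp add: power_add)
qed

lemma has_weak_deriv_refl:
  "f absolutely_integrable_on {a..b} \<Longrightarrow> has_weak_deriv a b 0 f f"
  by (simp add: has_weak_deriv_iff)

lemma has_weak_deriv_0_imp_AE_eq:
  assumes "a < b" and f: "f absolutely_integrable_on {a..b}" and g: "g absolutely_integrable_on {a..b}"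
    and wd: "has_weak_deriv a b 0 f g"
  shows "AE x in lebesgue_on {a..b}. f x = g x"
proof -
  have "AE x in lebesgue_on {a..b}. f x - g x = 0"
  proof (rule fundamental_lemma_calculus_of_variations[OF \<open>a < b\<close>])
    show "(\<lambda>x. f x - g x) absolutely_integrable_on {a..b}"
      using f g by (rule set_integral_diff(1))
    fix \<psi> assume \<psi>: "test_fun a b \<psi>"
    have int: "(\<lambda>x. h x * \<psi> x) integrable_on {a..b}" if "h absolutely_integrable_on {a..b}" for h
      by (intro set_lebesgue_integral_eq_integral(1) absolutely_integrable_mult_continuous that
        smooth_imp_continuous_on test_fun_imp_smooth[OF \<psi>])
    show "integral {a..b} (\<lambda>x. (f x - g x) * \<psi> x) = 0"
      using wd \<psi> int[OF f] int[OF g]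
      by (simp add: has_weak_deriv_iff[OF f g] left_diff_distrib Henstock_Kurzweil_Integration.integral_diff)
  qed
  then show ?thesis by eventually_elim simp
qed

lemma has_weak_deriv_primitive:
  assumes "a < b" and v: "v absolutely_integrable_on {a..b}"
  shows "has_weak_deriv a b 1 (primitive a v) v"
  unfolding has_weak_deriv_iff[OF primitive_absolutely_integrable[OF v] v]
proof (intro allI impI)
  fix \<phi> assume \<phi>: "test_fun a b \<phi>"
  then obtain d where "d < b" "\<And>x. d < x \<Longrightarrow> \<phi> x = 0"
    unfolding test_fun_iff[OF \<open>a < b\<close>] by force
  then have "\<phi> b = 0" by simp
  then show "integral {a..b} (\<lambda>x. primitive a v x * (deriv ^^ 1) \<phi> x) = (- 1) ^ 1 * integral {a..b} (\<lambda>x. v x * \<phi> x)"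
    using integral_primitive_mult_deriv[OF \<open>a < b\<close> v test_fun_imp_smooth[OF \<phi>]] by simp
qed

lemma has_weak_deriv_primitive_funpow:
  assumes "a < b" and v: "v absolutely_integrable_on {a..b}"
  shows "has_weak_deriv a b j ((primitive a ^^ (j + i)) v) ((primitive a ^^ i) v)"
proof (induction j)
  case 0
  show ?case using primitive_funpow_absolutely_integrable[OF v] by (simp add: has_weak_deriv_refl)
next
  case (Suc j)
  have "has_weak_deriv a b 1 (primitive a ((primitive a ^^ (j + i)) v)) ((primitive a ^^ (j + i)) v)"
    by (intro has_weak_deriv_primitive \<open>a < b\<close> primitive_funpow_absolutely_integrable v)
  from has_weak_deriv_trans[OF this Suc] show ?case by simp
qed

text \<open>
  The difference of \<open>h\<close> and the primitive of \<open>g\<close> has weak derivative zero, so it is constant by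
  du Bois-Reymond. By continuity it is so at every point, and its value at \<open>a\<close> is zero.
\<close>
lemma continuous_representative_eq_primitive:
  assumes "a < b" and g: "g absolutely_integrable_on {a..b}" and wd: "has_weak_deriv a b 1 f g"
    and h: "continuous_on {a..b} h" "h a = 0" and eq: "AE x in lebesgue_on {a..b}. f x = h x"
    and "x \<in> {a..b}"
  shows "h x = primitive a g x"
proof -
  have hL: "h absolutely_integrable_on {a..b}"
    using h(1) by (rule absolutely_integrable_continuous_real)
  have f: "f absolutely_integrable_on {a..b}"
    using hL by (rule absolutely_integrable_cong_AE) (use eq in \<open>auto elim: eventually_mono\<close>)
  have wd_h: "has_weak_deriv a b 1 h g"
    by (rule has_weak_deriv_cong_AE[OF f g eq _ wd]) auto
  note P = primitive_absolutely_integrable[OF g]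
  have "(\<lambda>x. h x - primitive a g x) absolutely_integrable_on {a..b}"
    using hL P by (rule set_integral_diff(1))
  moreover have "integral {a..b} (\<lambda>x. (h x - primitive a g x) * deriv \<psi> x) = 0" if \<psi>: "test_fun a b \<psi>" for \<psi>
  proof -
    have int: "(\<lambda>x. u x * deriv \<psi> x) integrable_on {a..b}" if "u absolutely_integrable_on {a..b}" for u
      by (intro set_lebesgue_integral_eq_integral(1) absolutely_integrable_mult_continuous that
        smooth_imp_continuous_on test_fun_imp_smooth[OF test_fun_deriv[OF \<psi>]])
    show ?thesis
      using wd_h has_weak_deriv_primitive[OF \<open>a < b\<close> g] \<psi> int[OF hL] int[OF P]
      by (simp add: has_weak_deriv_iff[OF hL g] has_weak_deriv_iff[OF P g] left_diff_distrib
        Henstock_Kurzweil_Integration.integral_diff)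
  qed
  ultimately obtain C where C: "AE x in lebesgue_on {a..b}. h x - primitive a g x = C"
    using du_Bois_Reymond[OF \<open>a < b\<close>] by blast
  have "h y - primitive a g y = C" if "y \<in> {a..b}" for y
    using continuous_eq_of_AE_eq[OF \<open>a < b\<close> _ _ C that] h(1) continuous_on_primitive[OF g]
    by (auto intro: continuous_intros)
  from this[of a] this[of x] show ?thesis
    using \<open>a < b\<close> \<open>x \<in> {a..b}\<close> \<open>h a = 0\<close> by simp
qed

section \<open>Fractional integrals and Sobolev spaces\<close>
lemma Lp_on_imp_absolutely_integrable:
  assumes "f \<in> Lp_on p {a..b}" "1 \<le> p"
  shows "f absolutely_integrable_on {a..b}"
proof -
  have m: "f \<in> borel_measurable (lebesgue_on {a..b})"
    and i: "integrable (lebesgue_on {a..b}) (\<lambda>x. \<bar>f x\<bar> powr p)"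
    using assms(1) by (auto simp: Lp_on_def)
  have "integrable (lebesgue_on {a..b}) (\<lambda>x. 1 :: real)"
    using absolutely_integrable_continuous_real[OF continuous_on_const, of a b "1 :: real"]
    by (simp add: integrable_restrict_space set_integrable_def)
  then have "integrable (lebesgue_on {a..b}) f"
  proof (rule Bochner_Integration.integrable_bound[OF Bochner_Integration.integrable_add[OF _ i] m])
    have "\<bar>y\<bar> \<le> 1 + \<bar>y\<bar> powr p" for y :: real
    proof (cases "\<bar>y\<bar> \<le> 1")
      case False
      then have "\<bar>y\<bar> powr 1 \<le> \<bar>y\<bar> powr p" using assms(2) by (intro powr_mono) auto
      then show ?thesis using False by simp
    qed (simp add: add_increasing2)
    then show "AE x in lebesgue_on {a..b}. norm (f x) \<le> norm (1 + \<bar>f x\<bar> powr p)"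
      by (auto intro!: AE_I2 simp: abs_of_nonneg)
  qed
  then show ?thesis by (simp add: integrable_restrict_space set_integrable_def)
qed

lemma Lp_on_of_continuous_representative:
  assumes h: "continuous_on {a..b} h" and eq: "AE x in lebesgue_on {a..b}. h x = f x" and "0 < p"
  shows "f \<in> Lp_on p {a..b}"
proof -
  have "h absolutely_integrable_on {a..b}"
    using h by (rule absolutely_integrable_continuous_real)
  from absolutely_integrable_cong_AE[OF this eq]
  have m [measurable]: "f \<in> borel_measurable (lebesgue_on {a..b})"
    by (rule absolutely_integrable_imp_borel_measurable) auto
  have "continuous_on {a..b} (\<lambda>x. \<bar>h x\<bar> powr p)"
    using h \<open>0 < p\<close> by (intro continuous_on_powr' continuous_intros) auto
  then have "(\<lambda>x. \<bar>h x\<bar> powr p) absolutely_integrable_on {a..b}"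
    by (rule absolutely_integrable_continuous_real)
  then have "integrable (lebesgue_on {a..b}) (\<lambda>x. \<bar>h x\<bar> powr p)"
    by (simp add: integrable_restrict_space set_integrable_def)
  then have "integrable (lebesgue_on {a..b}) (\<lambda>x. \<bar>f x\<bar> powr p)"
    by (rule integrable_cong_AE_imp) (use eq in \<open>auto elim: eventually_mono\<close>)
  with m show ?thesis by (simp add: Lp_on_def)
qed

lemma primitive_funpow_inject:
  assumes "a < b" and f: "f absolutely_integrable_on {a..b}" and g: "g absolutely_integrable_on {a..b}"
    and "AE x in lebesgue_on {a..b}. (primitive a ^^ k) f x = (primitive a ^^ k) g x"
  shows "AE x in lebesgue_on {a..b}. f x = g x"
  using assms(4)
proof (induction k)
  case (Suc k)
  note F = primitive_funpow_absolutely_integrable[OF f, of k]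
    and G = primitive_funpow_absolutely_integrable[OF g, of k]
  have ae: "AE x in lebesgue_on {a..b}.
      primitive a ((primitive a ^^ k) f) x = primitive a ((primitive a ^^ k) g) x"
    using Suc.prems by simp
  have "AE x in lebesgue_on {a..b}. (primitive a ^^ k) f x = (primitive a ^^ k) g x"
    by (rule AE_eq_of_primitive_eq[OF F G])
       (rule continuous_eq_of_AE_eq[OF \<open>a < b\<close> continuous_on_primitive[OF F] continuous_on_primitive[OF G] ae])
  then show ?case by (rule Suc.IH)
qed simp

text \<open>
  Integrating further, by the order that \<open>\<beta>\<close> lacks to a natural number, gives an iterated primitive.
  A function can be recovered from its primitive, and primitives are continuous, so equality almost
  everywhere carries through the iteration.
\<close>
lemma RL_integral_inject:
  assumes "a < b" "0 < \<beta>"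
    and f: "f absolutely_integrable_on {a..b}" and g: "g absolutely_integrable_on {a..b}"
    and eq: "AE x in lebesgue_on {a..b}. RL_integral a \<beta> f x = RL_integral a \<beta> g x"
  shows "AE x in lebesgue_on {a..b}. f x = g x"
proof -
  obtain N where N: "\<beta> < real (Suc N)"
    using reals_Archimedean2[of \<beta>] by (metis less_trans lessI of_nat_less_iff)
  define \<gamma> where "\<gamma> = real (Suc N) - \<beta>"
  have completed: "AE x in lebesgue_on {a..b}. RL_integral a \<gamma> (RL_integral a \<beta> v) x
      = (primitive a ^^ Suc N) v x" if v: "v absolutely_integrable_on {a..b}" for v
  proof -
    have "AE x in lebesgue_on {a..b}. RL_integral a \<gamma> (RL_integral a \<beta> v) x
        = RL_integral a (\<gamma> + \<beta>) v x"
      using \<open>0 < \<beta>\<close> N v by (intro RL_integral_semigroup) (auto simp: \<gamma>_def)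
    with RL_integral_nat[OF v, of N] show ?thesis
      by eventually_elim (simp add: \<gamma>_def)
  qed
  have "AE x in lebesgue_on {a..b}. RL_integral a \<gamma> (RL_integral a \<beta> f) x
      = RL_integral a \<gamma> (RL_integral a \<beta> g) x"
    using RL_integral_cong_AE[OF RL_integral_absolutely_integrable[OF \<open>0 < \<beta>\<close> f] eq]
    by (intro AE_I2) (auto simp: space_restrict_space)
  with completed[OF f] completed[OF g]
  have "AE x in lebesgue_on {a..b}. (primitive a ^^ Suc N) f x = (primitive a ^^ Suc N) g x"
    by eventually_elim simp
  then show ?thesis by (rule primitive_funpow_inject[OF \<open>a < b\<close> f g])
qed

text \<open>
  Induction on \<open>i\<close>, from the highest derivative downwards: the derivative of order \<open>n - i - 1\<close> has the
  one of order \<open>n - i\<close> as its weak derivative, and its value zero at \<open>a\<close> fixes the constant of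
  integration.
\<close>
lemma left_values_zero_imp_eq_primitive_funpow:
  assumes "a < b" and \<phi>: "\<phi> absolutely_integrable_on {a..b}" and wd: "has_weak_deriv a b n w \<phi>"
    and zero: "\<And>k. k \<in> {1..n} \<Longrightarrow> \<exists>g. has_weak_deriv a b (n - k) w g \<and> has_left_value a b g 0"
    and "1 \<le> i" "i \<le> n"
  shows "\<exists>g. has_weak_deriv a b (n - i) w g \<and> g absolutely_integrable_on {a..b} \<and>
    (AE x in lebesgue_on {a..b}. g x = (primitive a ^^ i) \<phi> x)"
  using \<open>1 \<le> i\<close> \<open>i \<le> n\<close>
proof (induction i)
  case (Suc i)
  obtain g h where g: "has_weak_deriv a b (n - Suc i) w g" and h: "continuous_on {a..b} h" "h a = 0"
    and eq: "AE x in lebesgue_on {a..b}. g x = h x"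
    using zero[of "Suc i"] Suc.prems by (auto simp: has_left_value_def)
  obtain G where G: "has_weak_deriv a b (n - i) w G" "G absolutely_integrable_on {a..b}"
    "AE x in lebesgue_on {a..b}. G x = (primitive a ^^ i) \<phi> x"
  proof (cases "i = 0")
    case True
    then show ?thesis using that[of \<phi>] wd \<phi> by simp
  next
    case False
    then show ?thesis using Suc.IH Suc.prems that by auto
  qed
  have "n - i = (n - Suc i) + 1" using Suc.prems by simp
  then have "has_weak_deriv a b 1 g G"
    using has_weak_deriv_cancel[OF g] G(1) by simp
  from continuous_representative_eq_primitive[OF \<open>a < b\<close> G(2) this h eq]
  have h_eq: "h x = (primitive a ^^ Suc i) \<phi> x" if "x \<in> {a..b}" for x
    using that primitive_cong_AE[OF G(3) that] by simp
  have "g absolutely_integrable_on {a..b}"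
    using absolutely_integrable_continuous_real[OF h(1)]
    by (rule absolutely_integrable_cong_AE) (use eq in \<open>auto elim: eventually_mono\<close>)
  moreover have "AE x in lebesgue_on {a..b}. g x = (primitive a ^^ Suc i) \<phi> x"
    using eq AE_space[of "lebesgue_on {a..b}"]
    by eventually_elim (use h_eq in \<open>simp add: space_restrict_space\<close>)
  ultimately show ?case using g by blast
qed simp

theorem theorem3p2:
  fixes a b \<alpha> p :: real and n m :: nat and u :: "real \<Rightarrow> real"
  assumes "a < b"
    and "u absolutely_integrable_on {a..b}"
    and "\<alpha> > 0" and "n \<ge> 1" and "real n - 1 \<le> \<alpha>" and "\<alpha> < real n"
    and "1 < p"
  shows "u \<in> RL_image a b \<alpha> (sobolev m p a b) \<longleftrightarrow>
    RL_integral a (real n - \<alpha>) u \<in> sobolev (m + n) p a b \<and>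
    (\<forall>k\<in>{1..n}. \<exists>g. has_RL_deriv a b n \<alpha> k u g \<and> has_left_value a b g 0)"
proof -
  define \<beta> where "\<beta> = real n - \<alpha>"
  have \<beta>: "0 < \<beta>" using assms by (simp add: \<beta>_def)
  note u = \<open>u absolutely_integrable_on {a..b}\<close>
  define w where "w = RL_integral a \<beta> u"
  have w: "w absolutely_integrable_on {a..b}"
    unfolding w_def using \<beta> u by (rule RL_integral_absolutely_integrable)
  have RL_RL: "AE x in lebesgue_on {a..b}. RL_integral a \<beta> (RL_integral a \<alpha> \<phi>) x = (primitive a ^^ n) \<phi> x"
    if \<phi>: "\<phi> absolutely_integrable_on {a..b}" for \<phi>
  proof -
    have "AE x in lebesgue_on {a..b}. RL_integral a \<beta> (RL_integral a \<alpha> \<phi>) x = RL_integral a (\<beta> + \<alpha>) \<phi> x"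
      using \<open>\<alpha> > 0\<close> \<beta> \<phi> by (intro RL_integral_semigroup)
    moreover have "AE x in lebesgue_on {a..b}. RL_integral a (real n) \<phi> x = (primitive a ^^ n) \<phi> x"
      using RL_integral_nat[OF \<phi>, of "n - 1"] \<open>n \<ge> 1\<close> by simp
    ultimately show ?thesis
      by eventually_elim (simp add: \<beta>_def)
  qed
  show ?thesis
    unfolding has_RL_deriv_def \<beta>_def[symmetric] w_def[symmetric]
  proof
    assume "u \<in> RL_image a b \<alpha> (sobolev m p a b)"
    then obtain \<phi> where \<phi>: "\<phi> \<in> sobolev m p a b" and u_eq: "AE x in lebesgue_on {a..b}. u x = RL_integral a \<alpha> \<phi> x"
      by (auto simp: RL_image_def)
    have \<phi>_Lp: "\<phi> \<in> Lp_on p {a..b}" using \<phi> by (simp add: sobolev_def)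
    then have \<phi>_L1: "\<phi> absolutely_integrable_on {a..b}"
      using \<open>1 < p\<close> by (intro Lp_on_imp_absolutely_integrable) auto
    note P = primitive_funpow_absolutely_integrable[OF \<phi>_L1]
    have cont: "continuous_on {a..b} ((primitive a ^^ i) \<phi>)" "(primitive a ^^ i) \<phi> a = 0" if "1 \<le> i" for i
      using that continuous_on_primitive[OF P[of "i - 1"]] by (cases i; simp)+
    have "AE x in lebesgue_on {a..b}. w x = RL_integral a \<beta> (RL_integral a \<alpha> \<phi>) x"
      unfolding w_def using RL_integral_cong_AE[OF u u_eq]
      by (intro AE_I2) (auto simp: space_restrict_space)
    with RL_RL[OF \<phi>_L1] have w_eq: "AE x in lebesgue_on {a..b}. (primitive a ^^ n) \<phi> x = w x"
      by eventually_elim simp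
    have wd: "has_weak_deriv a b (n - i) w ((primitive a ^^ i) \<phi>)" if "i \<le> n" for i
      by (rule has_weak_deriv_cong_AE[OF P P w_eq])
         (use has_weak_deriv_primitive_funpow[OF \<open>a < b\<close> \<phi>_L1, of "n - i" i] that in auto)
    have "\<exists>g\<in>Lp_on p {a..b}. has_weak_deriv a b k w g" if k: "k \<in> {1..m + n}" for k
    proof (cases "k < n")
      case True
      then have "(primitive a ^^ (n - k)) \<phi> \<in> Lp_on p {a..b}"
        using \<open>1 < p\<close> by (intro Lp_on_of_continuous_representative[OF cont(1)[of "n - k"]]) auto
      moreover have "has_weak_deriv a b k w ((primitive a ^^ (n - k)) \<phi>)"
        using wd[of "n - k"] True by simp
      ultimately show ?thesis by blast
    next
      case False
      have n: "has_weak_deriv a b n w \<phi>" using wd[of 0] by simp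
      show ?thesis
      proof (cases "k = n")
        case True
        with n \<phi>_Lp show ?thesis by blast
      next
        case False
        with \<open>\<not> k < n\<close> k have "k - n \<in> {1..m}" by auto
        then have "\<exists>g\<in>Lp_on p {a..b}. has_weak_deriv a b (k - n) \<phi> g"
          using \<phi> unfolding sobolev_def by blast
        then obtain g where "g \<in> Lp_on p {a..b}" "has_weak_deriv a b (k - n) \<phi> g"
          by blast
        with has_weak_deriv_trans[OF n this(2)] \<open>\<not> k < n\<close> show ?thesis by auto
      qed
    qed
    moreover have "w \<in> Lp_on p {a..b}"
      using \<open>1 < p\<close> \<open>n \<ge> 1\<close> by (intro Lp_on_of_continuous_representative[OF cont(1) w_eq]) auto
    ultimately have "w \<in> sobolev (m + n) p a b" by (simp add: sobolev_def)
    moreover have "has_left_value a b ((primitive a ^^ k) \<phi>) 0" if "1 \<le> k" for k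
      using cont[OF that] unfolding has_left_value_def by blast
    ultimately show "w \<in> sobolev (m + n) p a b \<and>
        (\<forall>k\<in>{1..n}. \<exists>g. has_weak_deriv a b (n - k) w g \<and> has_left_value a b g 0)"
      using wd by force
  next
    assume R: "w \<in> sobolev (m + n) p a b \<and>
        (\<forall>k\<in>{1..n}. \<exists>g. has_weak_deriv a b (n - k) w g \<and> has_left_value a b g 0)"
    then have deriv_w: "\<exists>g\<in>Lp_on p {a..b}. has_weak_deriv a b k w g" if "k \<in> {1..m + n}" for k
      using that by (auto simp: sobolev_def)
    obtain \<phi> where \<phi>_Lp: "\<phi> \<in> Lp_on p {a..b}" and n: "has_weak_deriv a b n w \<phi>"
      using deriv_w[of n] \<open>n \<ge> 1\<close> by auto
    have \<phi>_L1: "\<phi> absolutely_integrable_on {a..b}"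
      using \<phi>_Lp \<open>1 < p\<close> by (intro Lp_on_imp_absolutely_integrable) auto
    have "\<exists>g\<in>Lp_on p {a..b}. has_weak_deriv a b k \<phi> g" if "k \<in> {1..m}" for k
      using deriv_w[of "n + k"] that has_weak_deriv_cancel[OF n] by auto
    then have \<phi>: "\<phi> \<in> sobolev m p a b" using \<phi>_Lp by (simp add: sobolev_def)
    obtain g where g: "has_weak_deriv a b 0 w g" "g absolutely_integrable_on {a..b}"
      "AE x in lebesgue_on {a..b}. g x = (primitive a ^^ n) \<phi> x"
      using left_values_zero_imp_eq_primitive_funpow[OF \<open>a < b\<close> \<phi>_L1 n, of n] R \<open>n \<ge> 1\<close> by auto
    have "AE x in lebesgue_on {a..b}. RL_integral a \<beta> u x = RL_integral a \<beta> (RL_integral a \<alpha> \<phi>) x"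
      using has_weak_deriv_0_imp_AE_eq[OF \<open>a < b\<close> w g(2,1)] g(3) RL_RL[OF \<phi>_L1]
      by eventually_elim (simp add: w_def)
    then have "AE x in lebesgue_on {a..b}. u x = RL_integral a \<alpha> \<phi> x"
      by (rule RL_integral_inject[OF \<open>a < b\<close> \<beta> u RL_integral_absolutely_integrable[OF \<open>\<alpha> > 0\<close> \<phi>_L1]])
    with \<phi> show "u \<in> RL_image a b \<alpha> (sobolev m p a b)"
      by (auto simp: RL_image_def)
  qed
qed

end
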